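(* For each $N$, consider a discrete-time, irreducible, monotone and symmetric birth-and-death chain on $\{0,\ldots,2N+1\}$ started at $0$, and let $1=\lambda_0>\lambda_1^{(N)}>\cdots>\lambda_{2N+1}^{(N)}$ be the eigenvalues of its transition kernel. If $$(1-\lambda_1^{(N)})\sum_{k=1}^{2N+1}\frac{1}{1-\lambda_k^{(N)}}\longrightarrow+\infty\quad\text{as } N\to+\infty,$$ then the family of chains has a cutoff at time $$\frac12\sum_{k=1}^{2N+1}\frac{1}{1-\lambda_k^{(N)}}$$ for total variation.
   Context: A birth-and-death chain on $\{0,\ldots,M\}$ is a Markov chain with transition kernel $k$ satisfying $k(x,y)=0$ for $|x-y|>1$; put $p_x=k(x,x+1)$, $q_x=k(x,x-1)$, $r_x=k(x,x)$, so $p_x+q_x+r_x=1$ (with $q_0=p_M=0$). Irreducibility means $p_x>0$ for $0\le x\le M-1$ and $q_x>0$ for $1\le x\le M$. It is monotone if $p_x+q_{x+1}\le 1$ for all $0\le x\le M-1$. It is symmetric if $k(M-x,M-y)=k(x,y)$ for all $x,y$. Here $M=2N+1$. Let $d^{(N)}(n)$ be the total variation distance between the law at time $n$ and the stationary distribution. There is a cutoff at $t_N$ for total variation if for every fixed $c>1$, $d^{(N)}([ct_N])\to 0$ and for every fixed $0<c<1$, $d^{(N)}([ct_N])\to 1$ as $N\to\infty$ ($[\cdot]$ is the integer part). *)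

theory Defs
  imports Complex_Main "Jordan_Normal_Form.Char_Poly"
begin

text \<open>
  A kernel on the state space \<open>{0..M}\<close> is a function on all of \<open>nat\<close>; only its values on
  \<open>{0..M}\<close> matter. In the usual notation \<open>p x = K x (x + 1)\<close> and \<open>q x = K x (x - 1)\<close>.
\<close>

definition birth_death_chain :: "nat \<Rightarrow> (nat \<Rightarrow> nat \<Rightarrow> real) \<Rightarrow> bool" where
  "birth_death_chain M K \<longleftrightarrow>
     (\<forall>x\<le>M. \<forall>y\<le>M. 0 \<le> K x y) \<and>
     (\<forall>x\<le>M. (\<Sum>y\<le>M. K x y) = 1) \<and>
     (\<forall>x\<le>M. \<forall>y\<le>M. \<bar>int x - int y\<bar> > 1 \<longrightarrow> K x y = 0)"

definition irreducible_chain :: "nat \<Rightarrow> (nat \<Rightarrow> nat \<Rightarrow> real) \<Rightarrow> bool" where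
  "irreducible_chain M K \<longleftrightarrow>
     (\<forall>x<M. 0 < K x (x + 1)) \<and> (\<forall>x. 1 \<le> x \<and> x \<le> M \<longrightarrow> 0 < K x (x - 1))"

definition monotone_chain :: "nat \<Rightarrow> (nat \<Rightarrow> nat \<Rightarrow> real) \<Rightarrow> bool" where
  "monotone_chain M K \<longleftrightarrow> (\<forall>x<M. K x (x + 1) + K (x + 1) x \<le> 1)"

definition symmetric_chain :: "nat \<Rightarrow> (nat \<Rightarrow> nat \<Rightarrow> real) \<Rightarrow> bool" where
  "symmetric_chain M K \<longleftrightarrow> (\<forall>x\<le>M. \<forall>y\<le>M. K (M - x) (M - y) = K x y)"

definition kernel_mat :: "nat \<Rightarrow> (nat \<Rightarrow> nat \<Rightarrow> real) \<Rightarrow> real mat" where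
  "kernel_mat M K = mat (M + 1) (M + 1) (\<lambda>(x, y). K x y)"

text \<open>\<open>chain_law M K x0 n y\<close> is the probability that the chain started at \<open>x0\<close> is in \<open>y\<close> at time \<open>n\<close>.\<close>

primrec chain_law :: "nat \<Rightarrow> (nat \<Rightarrow> nat \<Rightarrow> real) \<Rightarrow> nat \<Rightarrow> nat \<Rightarrow> nat \<Rightarrow> real" where
  "chain_law M K x0 0 = (\<lambda>y. if y = x0 then 1 else 0)"
| "chain_law M K x0 (Suc n) = (\<lambda>y. \<Sum>x\<le>M. chain_law M K x0 n x * K x y)"

definition stationary_distribution :: "nat \<Rightarrow> (nat \<Rightarrow> nat \<Rightarrow> real) \<Rightarrow> (nat \<Rightarrow> real) \<Rightarrow> bool" where
  "stationary_distribution M K \<pi> \<longleftrightarrow>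
     (\<forall>x\<le>M. 0 \<le> \<pi> x) \<and> (\<Sum>x\<le>M. \<pi> x) = 1 \<and> (\<forall>y\<le>M. (\<Sum>x\<le>M. \<pi> x * K x y) = \<pi> y)"

text \<open>Normalised so that the total variation distance of probabilities takes values in \<open>[0, 1]\<close>.\<close>

definition tv_dist :: "nat \<Rightarrow> (nat \<Rightarrow> real) \<Rightarrow> (nat \<Rightarrow> real) \<Rightarrow> real" where
  "tv_dist M \<mu> \<nu> = Max ((\<lambda>A. \<bar>sum \<mu> A - sum \<nu> A\<bar>) ` Pow {..M})"

definition has_cutoff :: "(nat \<Rightarrow> nat \<Rightarrow> real) \<Rightarrow> (nat \<Rightarrow> real) \<Rightarrow> bool" where
  "has_cutoff d t \<longleftrightarrow>
     (\<forall>c>1. (\<lambda>N. d N (nat \<lfloor>c * t N\<rfloor>)) \<longlonglongrightarrow> 0) \<and>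
     (\<forall>c. 0 < c \<and> c < 1 \<longrightarrow> (\<lambda>N. d N (nat \<lfloor>c * t N\<rfloor>)) \<longlonglongrightarrow> 1)"

end

theory Submission
  imports Defs "HOL-Real_Asymp.Real_Asymp"
begin

text \<open>
  Write \<open>M = 2N + 1\<close>, let \<open>\<mu>\<close> be the law at time \<open>n\<close> and let \<open>G = \<mu> {0..N} - \<mu> {N+1..M}\<close>. The whole
  proof follows this one number. Monotonicity makes the density \<open>\<mu> / \<pi>\<close> decreasing at all times,
  and a decreasing density that gives nearly the same mass to both halves must be nearly constant:
  the total variation distance is at most \<open>2 G\<close> (\<open>tv_le_2G\<close>).

  The decay of \<open>G\<close> is governed by the antisymmetric part of the spectrum. Let \<open>Q x z\<close> be the
  solution of \<open>K Q = z Q\<close> with \<open>Q 0 z = 1\<close>, and extend it antisymmetrically from the left half to a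
  function \<open>psi z\<close>. Then \<open>psi z\<close> is an eigenfunction up to a defect at the middle edge
  proportional to \<open>P z = (Q N z + Q (N+1) z) / 2\<close>. One step of the chain multiplies the integral of
  \<open>psi z\<close> by \<open>z\<close> and subtracts \<open>P z\<close> times the amount by which \<open>G\<close> decreases
  (\<open>ip_psi_step\<close>). In the case of a hitting time \<open>\<tau>\<close> of the middle with tail \<open>G\<close> this says that
  \<open>1 / P z\<close> is the expectation of \<open>z\<close> to the power \<open>-\<tau>\<close>, and the two Chernoff bounds read
  \<open>G \<le> z\<^sup>n / P z\<close> for \<open>z\<close> between the second eigenvalue and \<open>1\<close>, and \<open>1 - G \<le> z\<^sup>n / P z\<close> for \<open>z \<ge> 1\<close>
  (\<open>G_upper\<close>, \<open>G_lower\<close>). The kernel folded antisymmetrically can have a negative entry, so there need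
  not be such a \<open>\<tau>\<close>; decreasing densities replace positivity of the kernel.

  The roots of \<open>P\<close> are the eigenvalues with antisymmetric eigenfunction. A Wronskian argument shows
  that they alternate with the symmetric ones, so they are those of odd index, and
  \<open>P (1 + v)\<close> is the product of \<open>1 + v / (1 - \<lambda>)\<close> over these (\<open>P_prod\<close>). Alternation also
  shows that their sum of \<open>1 / (1 - \<lambda>)\<close> is half the full sum \<open>2t\<close> up to \<open>1 / (2 gap)\<close>
  (\<open>odd_sum_bounds\<close>). With \<open>v = \<plusminus>\<theta> / t\<close> and \<open>\<theta>\<close> small compared to \<open>gap * t\<close> all factors are close to
  \<open>1\<close>, so \<open>P\<close> is about \<open>exp (\<plusminus>\<theta>)\<close>, and at \<open>n = c t\<close> the Chernoff bounds are about \<open>exp (-\<theta> \<bar>c - 1\<bar>)\<close>.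

  For \<open>c > 1\<close> this gives convergence to \<open>0\<close>. For \<open>c < 1\<close> it only shows that almost no mass has
  crossed the middle, whereas the distance must tend to \<open>1\<close>. But mass that \<open>\<mu>\<close> shares with
  \<open>\<pi>\<close> is balanced between the two halves after a further time of a few multiples of \<open>1 / gap\<close>, which is
  negligible compared to \<open>t\<close>; since even then almost nothing has crossed the middle, \<open>\<mu>\<close> and \<open>\<pi>\<close> can
  share almost no mass (\<open>overlap_bound\<close>, \<open>average_decay\<close>).
\<close>

section \<open>Wronskians, sums and the polynomials of a chain\<close>

text \<open>
  If \<open>g\<close> had no root there, \<open>f / g\<close> would be strictly increasing with value \<open>0\<close> at both ends.
\<close>

lemma wronskian_root_between:
  fixes f g :: "real poly"
  assumes W: "\<And>x. 0 < poly (pderiv f * g - f * pderiv g) x"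
    and ab: "a < b" "poly f a = 0" "poly f b = 0"
  shows "\<exists>c. a < c \<and> c < b \<and> poly g c = 0"
proof (rule ccontr)
  assume no: "\<not> ?thesis"
  have g0: "poly g x \<noteq> 0" if "a \<le> x" "x \<le> b" for x
  proof
    assume "poly g x = 0"
    moreover from this no that have "x = a \<or> x = b" by force
    ultimately show False using W[of x] ab by auto
  qed
  have "poly f a / poly g a < poly f b / poly g b"
  proof (rule DERIV_pos_imp_increasing[OF ab(1)])
    fix x assume x: "a \<le> x" "x \<le> b"
    have "((\<lambda>x. poly f x / poly g x) has_real_derivative
        (poly (pderiv f) x * poly g x - poly f x * poly (pderiv g) x) / (poly g x * poly g x)) (at x)"
      by (rule DERIV_divide[OF poly_DERIV poly_DERIV g0[OF x]])
    moreover have "0 < (poly (pderiv f) x * poly g x - poly f x * poly (pderiv g) x) / (poly g x * poly g x)"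
      using W[of x] g0[OF x] by (intro divide_pos_pos) (auto simp: not_square_less_zero zero_less_mult_iff)
    ultimately show "\<exists>y. ((\<lambda>x. poly f x / poly g x) has_real_derivative y) (at x) \<and> 0 < y" by blast
  qed
  then show False using ab by simp
qed

lemma wronskian_positive_left:
  fixes f g :: "real poly"
  assumes W: "\<And>x. 0 < poly (pderiv f * g - f * pderiv g) x"
    and f: "\<And>x. a \<le> x \<Longrightarrow> x \<le> b \<Longrightarrow> 0 < poly f x"
    and ab: "a \<le> b" "0 < poly g b"
  shows "0 < poly g a"
proof -
  have "poly g b / poly f b \<le> poly g a / poly f a"
  proof (rule DERIV_nonpos_imp_nonincreasing[OF ab(1)])
    fix x assume x: "a \<le> x" "x \<le> b"
    have "((\<lambda>x. poly g x / poly f x) has_real_derivative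
        (poly (pderiv g) x * poly f x - poly g x * poly (pderiv f) x) / (poly f x * poly f x)) (at x)"
      using f[OF x] by (intro DERIV_divide poly_DERIV) auto
    moreover have "(poly (pderiv g) x * poly f x - poly g x * poly (pderiv f) x) / (poly f x * poly f x) \<le> 0"
      using W[of x] f[OF x] by (intro divide_nonpos_pos) (auto simp: algebra_simps)
    ultimately show "\<exists>y. ((\<lambda>x. poly g x / poly f x) has_real_derivative y) (at x) \<and> y \<le> 0" by blast
  qed
  moreover have "0 < poly g b / poly f b" using ab f[of b] by simp
  ultimately have "0 < poly g a / poly f a" by linarith
  then show ?thesis using f[of a] ab by (auto simp: zero_less_divide_iff)
qed

lemma Chebyshev_sum_weighted:
  fixes w f g :: "nat \<Rightarrow> real"
  assumes "finite A" "\<And>x. x \<in> A \<Longrightarrow> 0 \<le> w x"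
    and f: "\<And>x y. x \<in> A \<Longrightarrow> y \<in> A \<Longrightarrow> x \<le> y \<Longrightarrow> f y \<le> f x"
    and g: "\<And>x y. x \<in> A \<Longrightarrow> y \<in> A \<Longrightarrow> x \<le> y \<Longrightarrow> g y \<le> g x"
  shows "(\<Sum>x\<in>A. w x * f x) * (\<Sum>x\<in>A. w x * g x) \<le> (\<Sum>x\<in>A. w x) * (\<Sum>x\<in>A. w x * f x * g x)"
proof -
  have "0 \<le> (\<Sum>x\<in>A. \<Sum>y\<in>A. w x * w y * ((f x - f y) * (g x - g y)))"
  proof (intro sum_nonneg)
    fix x y assume xy: "x \<in> A" "y \<in> A"
    have "0 \<le> (f x - f y) * (g x - g y)"
      using f[of x y] f[of y x] g[of x y] g[of y x] xy
      by (cases "x \<le> y") (auto intro: mult_nonneg_nonneg mult_nonpos_nonpos)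
    then show "0 \<le> w x * w y * ((f x - f y) * (g x - g y))"
      using assms(2) xy by simp
  qed
  also have "\<dots> = (\<Sum>x\<in>A. \<Sum>y\<in>A. (w x * f x * g x) * w y) + (\<Sum>x\<in>A. \<Sum>y\<in>A. w x * (w y * f y * g y))
      - (\<Sum>x\<in>A. \<Sum>y\<in>A. (w x * f x) * (w y * g y)) - (\<Sum>x\<in>A. \<Sum>y\<in>A. (w x * g x) * (w y * f y))"
    unfolding sum.distrib[symmetric] sum_subtractf[symmetric]
    by (intro sum.cong refl) (simp add: algebra_simps)
  also have "\<dots> = 2 * ((\<Sum>x\<in>A. w x) * (\<Sum>x\<in>A. w x * f x * g x))
      - 2 * ((\<Sum>x\<in>A. w x * f x) * (\<Sum>x\<in>A. w x * g x))"
    unfolding sum_product[symmetric] by simp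
  finally show ?thesis by linarith
qed

lemma sum_atMost_reflect:
  fixes f :: "nat \<Rightarrow> 'a::comm_monoid_add"
  shows "(\<Sum>x\<le>M. f (M - x)) = (\<Sum>x\<le>M. f x)"
  by (rule sum.reindex_bij_witness[of _ "\<lambda>x. M - x" "\<lambda>x. M - x"]) auto

lemma sum_fold:
  fixes f :: "nat \<Rightarrow> real"
  assumes "M = 2 * N + 1"
  shows "(\<Sum>x\<le>M. f x) = (\<Sum>x\<le>N. f x + f (M - x))"
proof -
  have "{..M} = {..N} \<union> {Suc N..M}" using assms by auto
  then have "(\<Sum>x\<le>M. f x) = (\<Sum>x\<le>N. f x) + (\<Sum>x\<in>{Suc N..M}. f x)"
    by (simp add: sum.union_disjoint)
  also have "(\<Sum>x\<in>{Suc N..M}. f x) = (\<Sum>x\<le>N. f (M - x))"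
    by (rule sum.reindex_bij_witness[of _ "\<lambda>x. M - x" "\<lambda>x. M - x"]) (use assms in auto)
  finally show ?thesis by (simp add: sum.distrib)
qed

text \<open>
  The orthogonal polynomials of the chain: the eigenfunction equation \<open>K f = z f\<close> with \<open>f 0 = 1\<close>,
  solved for \<open>f (x + 1)\<close>. At \<open>x = 0\<close> the truncated \<open>x - 1\<close> makes the last difference vanish, so that no
  separate equation is needed there.
\<close>

fun bd_poly :: "(nat \<Rightarrow> nat \<Rightarrow> real) \<Rightarrow> nat \<Rightarrow> real poly" where
  "bd_poly K 0 = 1"
| "bd_poly K (Suc x) = bd_poly K x + Polynomial.smult (1 / K x (Suc x))
     ([:-1, 1:] * bd_poly K x + Polynomial.smult (K x (x - 1)) (bd_poly K x - bd_poly K (x - 1)))"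

declare bd_poly.simps(2) [simp del]

lemma degree_bd_poly: "degree (bd_poly K x) \<le> x"
proof (induction x rule: less_induct)
  case (less x)
  show ?case
  proof (cases x)
    case (Suc y)
    have "degree (bd_poly K y) \<le> y" "degree (bd_poly K (y - 1)) \<le> Suc y"
      using less[of y] less[of "y - 1"] Suc by force+
    moreover have "degree ([:-1, 1:] * bd_poly K y) \<le> Suc y"
      using degree_mult_le[of "[:-1, 1:]" "bd_poly K y"] \<open>degree (bd_poly K y) \<le> y\<close> by simp
    ultimately show ?thesis unfolding Suc bd_poly.simps
      by (intro degree_add_le order.trans[OF degree_smult_le] degree_diff_le) auto
  qed simp
qed

lemma poly_bd_poly_1: "poly (bd_poly K x) 1 = 1"
proof (induction x rule: less_induct)
  case (less x)
  then show ?case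
    by (cases x) (auto simp: less_Suc_eq_le bd_poly.simps(2))
qed

section \<open>Reversibility and decreasing densities\<close>

locale sym_bd_chain =
  fixes M N :: nat and K :: "nat \<Rightarrow> nat \<Rightarrow> real" and \<pi> :: "nat \<Rightarrow> real"
  assumes M: "M = 2 * N + 1"
    and bd: "birth_death_chain M K"
    and irr: "irreducible_chain M K"
    and mono: "monotone_chain M K"
    and sym: "symmetric_chain M K"
    and stat: "stationary_distribution M K \<pi>"
begin

lemma left_less: "x \<le> N \<Longrightarrow> x < M"
    and reflect_left: "x \<le> N \<Longrightarrow> \<not> M - x \<le> N"
    and reflect_right: "\<not> x \<le> N \<Longrightarrow> M - x \<le> N"
    and middle: "M - N = Suc N" "M - Suc N = N"
    and left_le_reflect: "x \<le> N \<Longrightarrow> x \<le> M - x"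
  using M by auto

definition kop :: "(nat \<Rightarrow> real) \<Rightarrow> nat \<Rightarrow> real" where
  "kop f x = (\<Sum>y\<le>M. K x y * f y)"

lemma K_nonneg: "x \<le> M \<Longrightarrow> y \<le> M \<Longrightarrow> 0 \<le> K x y"
  and K_sum: "x \<le> M \<Longrightarrow> (\<Sum>y\<le>M. K x y) = 1"
  and K_far: "x \<le> M \<Longrightarrow> y \<le> M \<Longrightarrow> \<bar>int x - int y\<bar> > 1 \<Longrightarrow> K x y = 0"
  using bd unfolding birth_death_chain_def by auto

lemma K_zero: "x \<le> M \<Longrightarrow> y \<le> M \<Longrightarrow> y \<noteq> x \<Longrightarrow> y \<noteq> Suc x \<Longrightarrow> x \<noteq> Suc y \<Longrightarrow> K x y = 0"
  by (rule K_far) auto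

lemma up_pos: "x < M \<Longrightarrow> 0 < K x (Suc x)"
  and down_pos: "x < M \<Longrightarrow> 0 < K (Suc x) x"
  using irr unfolding irreducible_chain_def by auto force

lemma K_mono: "x < M \<Longrightarrow> K x (Suc x) + K (Suc x) x \<le> 1"
  using mono unfolding monotone_chain_def by auto

lemma K_sym: "x \<le> M \<Longrightarrow> y \<le> M \<Longrightarrow> K (M - x) (M - y) = K x y"
  using sym unfolding symmetric_chain_def by auto

lemma kop_gradient: "x \<le> M \<Longrightarrow> kop f x = f x + (\<Sum>y\<le>M. K x y * (f y - f x))"
  by (simp add: kop_def algebra_simps sum_subtractf sum_distrib_left[symmetric] K_sum)

lemma kop_interior:
  assumes "x < M"
  shows "kop f x = f x + K x (Suc x) * (f (Suc x) - f x) + K x (x - 1) * (f (x - 1) - f x)"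
proof -
  have "(\<Sum>y\<le>M. K x y * (f y - f x)) = (\<Sum>y\<in>{x - 1, x, Suc x}. K x y * (f y - f x))"
    by (rule sum.mono_neutral_right) (use assms in \<open>auto simp: K_zero\<close>)
  also have "\<dots> = K x (Suc x) * (f (Suc x) - f x) + K x (x - 1) * (f (x - 1) - f x)"
    by (cases x) auto
  finally show ?thesis using kop_gradient[of x f] assms by simp
qed

lemma kop_last: "kop f M = f M + K M (M - 1) * (f (M - 1) - f M)"
proof -
  have "(\<Sum>y\<le>M. K M y * (f y - f M)) = (\<Sum>y\<in>{M - 1, M}. K M y * (f y - f M))"
    by (rule sum.mono_neutral_right) (auto simp: K_zero)
  then show ?thesis using kop_gradient[of M f] M by simp
qed

lemma kop_cong: "(\<And>x. x \<le> M \<Longrightarrow> f x = g x) \<Longrightarrow> kop f = kop g"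
  by (auto simp: kop_def fun_eq_iff)

lemma kop_reflect: 
  assumes "x \<le> M"
  shows "kop f (M - x) = kop (\<lambda>y. f (M - y)) x"
proof -
  have "kop f (M - x) = (\<Sum>y\<le>M. K (M - x) (M - y) * f (M - y))"
    unfolding kop_def by (rule sum_atMost_reflect[symmetric])
  then show ?thesis using assms K_sym by (simp add: kop_def)
qed

definition decr :: "(nat \<Rightarrow> real) \<Rightarrow> bool" where
  "decr f \<longleftrightarrow> (\<forall>x<M. f (Suc x) \<le> f x)"

lemma decrD: 
  assumes "decr f" "x \<le> y" "y \<le> M" 
  shows "f y \<le> f x"
  using assms(2,3)
proof (induction y rule: dec_induct)
  case (step n)
  then have "f (Suc n) \<le> f n" using assms(1) unfolding decr_def by auto
  with step show ?case by simp
qed simp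

text \<open>
  The increments of \<open>kop f\<close> are combinations of those of \<open>f\<close> with the coefficients \<open>p (x + 1)\<close>,
  \<open>1 - p x - q (x + 1)\<close> and \<open>q x\<close>; the chain is monotone exactly when the middle one is nonnegative.
\<close>

lemma decr_kop:
  assumes "decr f"
  shows "decr (kop f)"
  unfolding decr_def
proof (intro allI impI)
  fix x assume x: "x < M"
  have d: "f (Suc y) - f y \<le> 0" if "y < M" for y using assms that by (auto simp: decr_def)
  have a: "(1 - K x (Suc x) - K (Suc x) x) * (f (Suc x) - f x) \<le> 0"
    using d[OF x] K_mono[OF x] by (intro mult_nonneg_nonpos) auto
  have b: "0 \<le> K x (x - 1) * (f (x - 1) - f x)"
    using K_nonneg[of x "x - 1"] x assms by (intro mult_nonneg_nonneg) (auto intro!: decrD)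
  show "kop f (Suc x) \<le> kop f x"
  proof (cases "Suc x = M")
    case True
    then show ?thesis using a b kop_last[of f] kop_interior[OF x, of f]
      by (auto simp: algebra_simps)
  next
    case False
    then have "Suc x < M" using x by simp
    moreover have "K (Suc x) (Suc (Suc x)) * (f (Suc (Suc x)) - f (Suc x)) \<le> 0"
      using d[OF \<open>Suc x < M\<close>] up_pos[OF \<open>Suc x < M\<close>] by (intro mult_nonneg_nonpos) auto
    ultimately show ?thesis using a b kop_interior[of "Suc x" f] kop_interior[OF x, of f]
      by (auto simp: algebra_simps)
  qed
qed

lemma pi_nonneg: "x \<le> M \<Longrightarrow> 0 \<le> \<pi> x"
  and pi_sum: "(\<Sum>x\<le>M. \<pi> x) = 1"
  and pi_stat: "y \<le> M \<Longrightarrow> (\<Sum>x\<le>M. \<pi> x * K x y) = \<pi> y"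
  using stat unfolding stationary_distribution_def by auto

lemma pi_flux: "x < M \<Longrightarrow> \<pi> x * K x (Suc x) = \<pi> (Suc x) * K (Suc x) x"
proof (induction x)
  case 0
  have "\<pi> 0 = (\<Sum>x\<in>{0, 1}. \<pi> x * K x 0)"
    unfolding pi_stat[of 0, simplified, symmetric]
    by (rule sum.mono_neutral_right) (use M in \<open>auto simp: K_zero\<close>)
  moreover have "1 = (\<Sum>y\<in>{0, 1}. K 0 y)"
    unfolding K_sum[of 0, simplified, symmetric]
    by (rule sum.mono_neutral_right) (use M in \<open>auto simp: K_zero\<close>)
  ultimately show ?case by (simp add: algebra_simps) (metis distrib_left mult.right_neutral add_left_cancel)
next
  case (Suc x)
  have "\<pi> (Suc x) = (\<Sum>y\<in>{x, Suc x, Suc (Suc x)}. \<pi> y * K y (Suc x))"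
    unfolding pi_stat[of "Suc x", symmetric, OF less_imp_le[OF Suc.prems]]
    by (rule sum.mono_neutral_right) (use Suc.prems in \<open>auto simp: K_zero\<close>)
  moreover have "1 = (\<Sum>y\<in>{x, Suc x, Suc (Suc x)}. K (Suc x) y)"
    unfolding K_sum[of "Suc x", symmetric, OF less_imp_le[OF Suc.prems]]
    by (rule sum.mono_neutral_right) (use Suc.prems in \<open>auto simp: K_zero\<close>)
  then have "\<pi> (Suc x) * 1 = \<pi> (Suc x) * (\<Sum>y\<in>{x, Suc x, Suc (Suc x)}. K (Suc x) y)" by simp
  ultimately show ?case using Suc by (simp add: algebra_simps)
qed

lemma detailed_balance:
  assumes "x \<le> M" "y \<le> M"
  shows "\<pi> x * K x y = \<pi> y * K y x"
proof -
  consider "y = Suc x" | "x = Suc y" | "x = y" | "y \<noteq> x" "y \<noteq> Suc x" "x \<noteq> Suc y" by blast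
  then show ?thesis
    using assms pi_flux[of x] pi_flux[of y] by cases (auto simp: K_zero)
qed

lemma pi_pos: assumes "x \<le> M" shows "0 < \<pi> x"
proof -
  have step: "\<pi> x = 0 \<longleftrightarrow> \<pi> (Suc x) = 0" if "x < M" for x
    using pi_flux[OF that] up_pos[OF that] down_pos[OF that] by auto
  have all: "\<pi> x = 0 \<longleftrightarrow> \<pi> 0 = 0" if "x \<le> M" for x
    using that by (induction x) (auto simp: step[symmetric])
  have "\<pi> 0 \<noteq> 0"
  proof
    assume "\<pi> 0 = 0"
    then have "\<pi> x = 0" if "x \<le> M" for x using all[OF that] by blast
    then have "(\<Sum>x\<le>M. \<pi> x) = 0" by (intro sum.neutral) blast
    then show False using pi_sum by simp
  qed
  then show ?thesis using all[OF assms] pi_nonneg[OF assms] by linarith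
qed

text \<open>
  The reflected distribution satisfies the same detailed balance equations, which determine a
  solution up to a factor.
\<close>

lemma pi_sym: assumes "x \<le> M" shows "\<pi> (M - x) = \<pi> x"
proof -
  define c where "c = \<pi> M / \<pi> 0"
  have eq: "\<pi> (M - x) = c * \<pi> x" if "x \<le> M" for x
    using that
  proof (induction x)
    case 0
    then show ?case using pi_pos[of 0] by (simp add: c_def)
  next
    case (Suc x)
    have "\<pi> (M - x) * K (M - x) (M - Suc x) = \<pi> (M - Suc x) * K (M - Suc x) (M - x)"
      using Suc.prems by (intro detailed_balance) auto
    then have "c * (\<pi> (Suc x) * K (Suc x) x) = \<pi> (M - Suc x) * K (Suc x) x"
      using Suc K_sym[of x "Suc x"] K_sym[of "Suc x" x] pi_flux[of x] by (simp add: mult.assoc)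
    then show ?case using down_pos[of x] Suc.prems by simp
  qed
  have "1 = (\<Sum>x\<le>M. \<pi> (M - x))" using sum_atMost_reflect[of \<pi>] pi_sum by simp
  also have "\<dots> = (\<Sum>x\<le>M. c * \<pi> x)" by (intro sum.cong) (auto simp: eq)
  finally have "c = 1" using pi_sum by (simp add: sum_distrib_left[symmetric])
  then show ?thesis using eq[OF assms] by simp
qed

lemma pi_half: "(\<Sum>x\<le>N. \<pi> x) = 1 / 2"
proof -
  have "(\<Sum>x\<le>M. \<pi> x) = (\<Sum>x\<le>N. 2 * \<pi> x)"
    unfolding sum_fold[OF M]
  proof (intro sum.cong refl)
    fix x assume "x \<in> {..N}"
    then show "\<pi> x + \<pi> (M - x) = 2 * \<pi> x" using pi_sym[of x] M by simp
  qed
  then show ?thesis using pi_sum by (simp add: sum_distrib_left[symmetric])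
qed

definition ip :: "(nat \<Rightarrow> real) \<Rightarrow> (nat \<Rightarrow> real) \<Rightarrow> real" where
  "ip f g = (\<Sum>x\<le>M. \<pi> x * f x * g x)"

lemma ip_kop: "ip (kop f) g = ip f (kop g)"
proof -
  have "ip (kop f) g = (\<Sum>x\<le>M. \<Sum>y\<le>M. (\<pi> x * K x y) * f y * g x)"
    by (simp add: ip_def kop_def sum_distrib_left sum_distrib_right mult.assoc)
  also have "\<dots> = (\<Sum>x\<le>M. \<Sum>y\<le>M. (\<pi> y * K y x) * f y * g x)"
    by (intro sum.cong refl) (simp add: detailed_balance)
  also have "\<dots> = (\<Sum>y\<le>M. \<Sum>x\<le>M. (\<pi> y * K y x) * f y * g x)"
    by (rule sum.swap)
  also have "\<dots> = ip f (kop g)"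
    by (simp add: ip_def kop_def sum_distrib_left sum_distrib_right mult_ac)
  finally show ?thesis .
qed

lemma ip_kop_pow: "ip ((kop ^^ n) f) g = ip f ((kop ^^ n) g)"
  by (induction n arbitrary: g) (simp_all add: ip_kop flip: funpow_swap1)

definition dens0 :: "nat \<Rightarrow> real" where
  "dens0 x = (if x = 0 then 1 / \<pi> 0 else 0)"

text \<open>
  By reversibility the density of the law evolves under \<open>kop\<close>; this is how the monotonicity of
  the chain reaches the law.
\<close>

lemma chain_law_dens:
  "x \<le> M \<Longrightarrow> chain_law M K 0 n x = \<pi> x * (kop ^^ n) dens0 x"
proof (induction n arbitrary: x)
  case 0
  then show ?case using pi_pos[of 0] by (simp add: dens0_def)
next
  case (Suc n)
  have "chain_law M K 0 (Suc n) x = (\<Sum>y\<le>M. (\<pi> y * K y x) * (kop ^^ n) dens0 y)"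
    using Suc.IH by (simp add: mult_ac)
  also have "\<dots> = (\<Sum>y\<le>M. (\<pi> x * K x y) * (kop ^^ n) dens0 y)"
    using detailed_balance Suc.prems by (intro sum.cong) auto
  also have "\<dots> = \<pi> x * kop ((kop ^^ n) dens0) x"
    unfolding kop_def[of "(kop ^^ n) dens0"] by (simp add: sum_distrib_left mult_ac)
  finally show ?case by simp
qed

lemma decr_dens: "decr ((kop ^^ n) dens0)"
proof (induction n)
  case 0
  then show ?case using pi_pos[of 0] by (simp add: dens0_def decr_def)
qed (simp add: decr_kop)

lemma ip_dens0: "ip dens0 f = f 0"
proof -
  have "ip dens0 f = (\<Sum>x\<in>{0}. \<pi> x * dens0 x * f x)"
    unfolding ip_def by (rule sum.mono_neutral_right) (auto simp: dens0_def)
  then show ?thesis using pi_pos[of 0] by (simp add: dens0_def)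
qed

section \<open>Eigenfunctions on the half chain\<close>

abbreviation Q :: "nat \<Rightarrow> real \<Rightarrow> real" where
  "Q x z \<equiv> poly (bd_poly K x) z"

text \<open>
  The defect of the antisymmetric extension of \<open>Q\<close> at the middle edge, normalised so that \<open>P 1 = 1\<close>.
\<close>

definition P :: "real \<Rightarrow> real" where
  "P z = (Q N z + Q (Suc N) z) / 2"

lemma Q_rec:
  assumes "x < M"
  shows "K x (Suc x) * (Q (Suc x) z - Q x z) = (z - 1) * Q x z + K x (x - 1) * (Q x z - Q (x - 1) z)"
  using up_pos[OF assms] by (simp add: bd_poly.simps(2) field_simps)

lemma kop_Q:
  assumes "x < M"
  shows "kop (\<lambda>y. Q y z) x = z * Q x z"
  unfolding kop_interior[OF assms] using Q_rec[OF assms, of z] by (simp add: algebra_simps)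

text \<open>
  Read from left to right, the recursion gives the increment at \<open>n\<close> as a nonnegative multiple of the
  previous increment plus \<open>(z - 1) * Q n z\<close> up to a positive factor.
\<close>

lemma Q_decreasing:
  assumes "z \<le> 1" "\<And>y. y \<le> n \<Longrightarrow> 0 \<le> Q y z" "n < M"
  shows "Q (Suc n) z \<le> Q n z"
  using assms(2,3)
proof (induction n)
  case 0
  have "K 0 (Suc 0) * (Q (Suc 0) z - Q 0 z) \<le> 0"
    using Q_rec[of 0 z] 0 assms(1) by simp
  then show ?case using up_pos[of 0] 0 by (auto simp: mult_le_0_iff)
next
  case (Suc n)
  have "K (Suc n) n * (Q (Suc n) z - Q n z) \<le> 0"
    using Suc K_nonneg[of "Suc n" n] by (intro mult_nonneg_nonpos) auto
  moreover have "(z - 1) * Q (Suc n) z \<le> 0"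
    using Suc.prems assms(1) by (intro mult_nonpos_nonneg) auto
  ultimately have "K (Suc n) (Suc (Suc n)) * (Q (Suc (Suc n)) z - Q (Suc n) z) \<le> 0"
    using Q_rec[OF Suc.prems(2), of z] by simp
  then show ?case using up_pos[OF Suc.prems(2)] by (simp add: mult_le_0_iff)
qed

lemma Q_ge_1:
  assumes "1 \<le> z" "x \<le> M"
  shows "1 \<le> Q x z"
proof -
  have "1 \<le> Q x z \<and> (x < M \<longrightarrow> Q x z \<le> Q (Suc x) z)" using assms(2)
  proof (induction x)
    case 0
    have "0 \<le> K 0 (Suc 0) * (Q (Suc 0) z - Q 0 z)"
      using Q_rec[of 0 z] M assms(1) by simp
    then show ?case using up_pos[of 0] M by (simp add: zero_le_mult_iff)
  next
    case (Suc n)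
    then have IH: "1 \<le> Q n z" "Q n z \<le> Q (Suc n) z" by auto
    have "Q (Suc n) z \<le> Q (Suc (Suc n)) z" if "Suc n < M"
    proof -
      have "0 \<le> K (Suc n) n * (Q (Suc n) z - Q n z)"
        using IH K_nonneg[of "Suc n" n] Suc.prems by (intro mult_nonneg_nonneg) auto
      moreover have "0 \<le> (z - 1) * Q (Suc n) z"
        using IH assms(1) by (intro mult_nonneg_nonneg) auto
      ultimately have "0 \<le> K (Suc n) (Suc (Suc n)) * (Q (Suc (Suc n)) z - Q (Suc n) z)"
        using Q_rec[OF that, of z] by simp
      then show ?thesis using up_pos[OF that] by (simp add: zero_le_mult_iff)
    qed
    then show ?case using IH by linarith
  qed
  then show ?thesis by simp
qed

text \<open>
  The Christoffel--Darboux positivity: with \<open>p\<close>, \<open>q\<close> the rates at \<open>x\<close>, the Wronskians satisfy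
  \<open>p * W x = (Q x)\<^sup>2 + q * W (x - 1)\<close>.
\<close>

lemma wronskian_Q:
  assumes "x < M"
  shows "0 < poly (pderiv (bd_poly K (Suc x)) * bd_poly K x - bd_poly K (Suc x) * pderiv (bd_poly K x)) z"
  using assms
proof (induction x)
  case 0
  then show ?case using up_pos[of 0] by (simp add: bd_poly.simps(2) pderiv_smult pderiv_add pderiv_pCons pderiv_diff)
next
  case (Suc x)
  define p q where "p = K (Suc x) (Suc (Suc x))" and "q = K (Suc x) x"
  define a a' where "a = poly (bd_poly K x) z" and "a' = poly (pderiv (bd_poly K x)) z"
  define b b' where "b = poly (bd_poly K (Suc x)) z" and "b' = poly (pderiv (bd_poly K (Suc x))) z"
  have p: "0 < p" using up_pos[of "Suc x"] Suc.prems by (simp add: p_def)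
  have q: "0 \<le> q" using K_nonneg[of "Suc x" x] Suc.prems by (simp add: q_def)
  have IH: "0 < b' * a - b * a'" using Suc by (simp add: a_def a'_def b_def b'_def)
  have "poly (bd_poly K (Suc (Suc x))) z = b + ((z - 1) * b + q * (b - a)) / p"
    using p unfolding bd_poly.simps(2)[of K "Suc x"] a_def b_def p_def q_def by (simp add: field_simps)
  moreover have "poly (pderiv (bd_poly K (Suc (Suc x)))) z = b' + (b + (z - 1) * b' + q * (b' - a')) / p"
    using p unfolding bd_poly.simps(2)[of K "Suc x"] a_def b_def a'_def b'_def p_def q_def
    by (simp add: field_simps pderiv_smult pderiv_add pderiv_mult pderiv_pCons pderiv_diff)
  ultimately have "poly (pderiv (bd_poly K (Suc (Suc x))) * bd_poly K (Suc x)
       - bd_poly K (Suc (Suc x)) * pderiv (bd_poly K (Suc x))) z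
     = (b' + (b + (z - 1) * b' + q * (b' - a')) / p) * b - (b + ((z - 1) * b + q * (b - a)) / p) * b'"
    by (simp add: b_def b'_def)
  also have "\<dots> = (b * b + q * (b' * a - b * a')) / p"
    using p by (simp add: field_simps)
  also have "0 < \<dots>"
  proof (intro divide_pos_pos p)
    show "0 < b * b + q * (b' * a - b * a')"
    proof (cases "b = 0")
      case True
      have "0 < q" using down_pos[of x] Suc.prems by (simp add: q_def)
      then show ?thesis using IH True by simp
    next
      case False
      then have "0 < b * b" by (metis not_real_square_gt_zero)
      moreover have "0 \<le> q * (b' * a - b * a')" using IH q by (intro mult_nonneg_nonneg) auto
      ultimately show ?thesis by linarith
    qed
  qed
  finally show ?case .
qed

text \<open>
  Positivity is inherited downwards, from \<open>P\<close> to \<open>Q N\<close> and from \<open>Q (n + 1)\<close> to \<open>Q n\<close>, because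
  the quotient of consecutive polynomials is monotone by the sign of the Wronskian and equals \<open>1\<close> at
  \<open>z = 1\<close>.
\<close>

lemma Q_pos:
  assumes P: "\<And>y. z \<le> y \<Longrightarrow> y \<le> 1 \<Longrightarrow> 0 < P y" and z: "z \<le> 1" and x: "x \<le> N"
  shows "0 < Q x z"
proof -
  have "\<forall>y. z \<le> y \<and> y \<le> 1 \<longrightarrow> 0 < Q x y" using x
  proof (induction x rule: inc_induct)
    case base
    show ?case
    proof (intro allI impI)
      fix y assume y: "z \<le> y \<and> y \<le> 1"
      show "0 < Q N y"
      proof (rule wronskian_positive_left[where f = "bd_poly K N + bd_poly K (Suc N)" and b = 1])
        fix t
        show "0 < poly (pderiv (bd_poly K N + bd_poly K (Suc N)) * bd_poly K N
            - (bd_poly K N + bd_poly K (Suc N)) * pderiv (bd_poly K N)) t"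
          using wronskian_Q[of N t] M by (simp add: algebra_simps pderiv_add)
      next
        fix t assume "y \<le> t" "t \<le> 1"
        then show "0 < poly (bd_poly K N + bd_poly K (Suc N)) t"
          using P[of t] y by (simp add: P_def)
      qed (use y in \<open>auto simp: poly_bd_poly_1\<close>)
    qed
  next
    case (step n)
    show ?case
    proof (intro allI impI)
      fix y assume y: "z \<le> y \<and> y \<le> 1"
      show "0 < Q n y"
        by (rule wronskian_positive_left[where f = "bd_poly K (Suc n)" and b = 1])
          (use y step wronskian_Q[of n] M in \<open>auto simp: poly_bd_poly_1\<close>)
    qed
  qed
  then show ?thesis using z by simp
qed

definition psi :: "real \<Rightarrow> nat \<Rightarrow> real" where
  "psi z x = (if x \<le> N then Q x z else - Q (M - x) z)"

lemma psi_reflect: "x \<le> M \<Longrightarrow> psi z (M - x) = - psi z x"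
  by (auto simp: psi_def reflect_left reflect_right)

lemma kop_psi_left:
  assumes "x \<le> N"
  shows "kop (psi z) x = z * psi z x - (if x = N then 2 * K N (Suc N) * P z else 0)"
proof (cases "x = N")
  case False
  then have "x < N" using assms by simp
  then have "x - 1 \<le> N" by simp
  with \<open>x < N\<close> have "kop (psi z) x = kop (\<lambda>y. Q y z) x"
    by (simp add: kop_interior psi_def left_less)
  then show ?thesis using kop_Q[of x z] \<open>x < N\<close> left_less[of x] by (simp add: psi_def)
next
  case True
  have "kop (psi z) N = kop (\<lambda>y. Q y z) N - 2 * K N (Suc N) * P z"
    by (simp add: kop_interior left_less middle psi_def P_def field_simps)
  then show ?thesis using kop_Q[of N z] True left_less[of N] by (simp add: psi_def)
qed

lemma ip_fold: "ip h (psi z) = (\<Sum>x\<le>N. \<pi> x * (h x - h (M - x)) * Q x z)"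
  unfolding ip_def sum_fold[OF M]
proof (intro sum.cong refl)
  fix x assume "x \<in> {..N}"
  then have "x \<le> M" "x \<le> N" using M by auto
  then show "\<pi> x * h x * psi z x + \<pi> (M - x) * h (M - x) * psi z (M - x)
      = \<pi> x * (h x - h (M - x)) * Q x z"
    using psi_reflect[of x z] pi_sym[of x] by (simp add: psi_def algebra_simps)
qed

text \<open>
  The amount by which \<open>G\<close> decreases in one step, see \<open>G_step\<close> below: the net mass that crosses the
  middle edge, counted twice because both halves change.
\<close>

definition flux :: "(nat \<Rightarrow> real) \<Rightarrow> real" where
  "flux h = 2 * \<pi> N * K N (Suc N) * (h N - h (Suc N))"

lemma flux_nonneg: "decr h \<Longrightarrow> 0 \<le> flux h"
  unfolding flux_def using left_less[of N] pi_nonneg[of N] K_nonneg[of N "Suc N"]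
  by (intro mult_nonneg_nonneg) (auto simp: decr_def)

text \<open>
  The kernel is moved to \<open>psi z\<close> by self-adjointness, and \<open>psi z\<close> fails to be an eigenfunction only
  at the two middle points.
\<close>

lemma ip_psi_step: "ip (kop h) (psi z) = z * ip h (psi z) - P z * flux h"
proof -
  have "kop (psi z) (M - x) = - kop (psi z) x" if "x \<le> M" for x
    unfolding kop_reflect[OF that] using psi_reflect
    by (simp add: kop_def sum_negf)
  then have "ip h (kop (psi z)) = (\<Sum>x\<le>N. \<pi> x * (h x - h (M - x)) * kop (psi z) x)"
    unfolding ip_def sum_fold[OF M] using M pi_sym
    by (intro sum.cong refl) (simp add: algebra_simps)
  also have "\<dots> = (\<Sum>x\<le>N. z * (\<pi> x * (h x - h (M - x)) * Q x z)
      - (if x = N then \<pi> N * (h N - h (M - N)) * (2 * K N (Suc N) * P z) else 0))"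
    by (intro sum.cong refl) (auto simp: kop_psi_left psi_def algebra_simps)
  also have "\<dots> = z * ip h (psi z) - \<pi> N * (h N - h (M - N)) * (2 * K N (Suc N) * P z)"
    by (simp add: sum_subtractf sum_distrib_left ip_fold)
  also have "M - N = Suc N" using M by simp
  finally show ?thesis by (simp add: ip_kop flux_def algebra_simps)
qed

lemma P_1: "P 1 = 1" by (simp add: P_def poly_bd_poly_1)

lemma fold_nonneg: "decr h \<Longrightarrow> x \<le> N \<Longrightarrow> 0 \<le> \<pi> x * (h x - h (M - x))"
  using pi_nonneg[of x] decrD[of h x "M - x"] M by (intro mult_nonneg_nonneg) auto

abbreviation G :: "(nat \<Rightarrow> real) \<Rightarrow> real" where
  "G h \<equiv> ip h (psi 1)"

lemma G_step: "G (kop h) = G h - flux h"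
  using ip_psi_step[of h 1] by (simp add: P_1)

lemma decr_kop_pow: "decr h \<Longrightarrow> decr ((kop ^^ n) h)"
  by (induction n) (auto simp: decr_kop)

lemma ip_psi_decay:
  assumes "decr h" "0 \<le> z" "0 \<le> P z"
  shows "ip ((kop ^^ n) h) (psi z) \<le> z ^ n * ip h (psi z)"
proof (induction n)
  case (Suc n)
  have "0 \<le> P z * flux ((kop ^^ n) h)"
    using assms by (intro mult_nonneg_nonneg flux_nonneg decr_kop_pow)
  then have "ip ((kop ^^ Suc n) h) (psi z) \<le> z * ip ((kop ^^ n) h) (psi z)"
    by (simp add: ip_psi_step)
  also have "\<dots> \<le> z * (z ^ n * ip h (psi z))"
    using Suc assms by (intro mult_left_mono)
  finally show ?case by (simp add: mult.assoc)
qed simp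

lemma Q_ge_P:
  assumes P: "\<And>y. z \<le> y \<Longrightarrow> y \<le> 1 \<Longrightarrow> 0 < P y" and z: "z \<le> 1" and x: "x \<le> N"
  shows "P z \<le> Q x z" and "x < N \<Longrightarrow> Q (Suc x) z \<le> Q x z"
proof -
  have pos: "0 \<le> Q y z" if "y \<le> N" for y
    using Q_pos[OF P z that] by simp
  have d: "Q (Suc y) z \<le> Q y z" if "y \<le> N" for y
    using pos that z left_less[OF that] by (intro Q_decreasing) auto
  then show "x < N \<Longrightarrow> Q (Suc x) z \<le> Q x z" by simp
  have "Q N z \<le> Q x z" using x
  proof (induction x rule: inc_induct)
    case (step n)
    then show ?case using d[of n] by simp
  qed simp
  moreover have "P z \<le> Q N z" using d[of N] by (simp add: P_def)
  ultimately show "P z \<le> Q x z" by simp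
qed

text \<open>
  Chernoff bound with \<open>z \<le> 1\<close>: here \<open>psi z\<close> dominates \<open>P z\<close> on the left half, so its integral, which
  decays at least as \<open>z ^ n\<close>, controls \<open>G\<close>.
\<close>

lemma G_upper:
  assumes P: "\<And>y. z \<le> y \<Longrightarrow> y \<le> 1 \<Longrightarrow> 0 < P y" and z: "0 \<le> z" "z \<le> 1"
  shows "G ((kop ^^ n) dens0) \<le> z ^ n / P z"
proof -
  let ?h = "(kop ^^ n) dens0"
  have "P z * G ?h = (\<Sum>x\<le>N. \<pi> x * (?h x - ?h (M - x)) * P z)"
    by (simp add: ip_fold poly_bd_poly_1 sum_distrib_left mult_ac)
  also have "\<dots> \<le> ip ?h (psi z)"
    unfolding ip_fold
    by (intro sum_mono mult_left_mono Q_ge_P[OF P z(2)] fold_nonneg decr_dens) auto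
  also have "\<dots> \<le> z ^ n * ip dens0 (psi z)"
    using decr_dens[of 0] P[of z] z by (intro ip_psi_decay) auto
  also have "ip dens0 (psi z) = 1" by (simp add: ip_dens0 psi_def)
  finally show ?thesis using P[of z] z by (simp add: pos_le_divide_eq mult.commute)
qed

text \<open>
  Chernoff bound with \<open>z \<ge> 1\<close>: each time \<open>G\<close> decreases, the integral of \<open>psi z\<close> pays \<open>P z\<close> times
  the decrease, and it never becomes negative.
\<close>

lemma G_lower:
  assumes z: "1 \<le> z"
  shows "1 - G ((kop ^^ n) dens0) \<le> z ^ n / P z"
proof -
  let ?h = "\<lambda>n. (kop ^^ n) dens0"
  have P: "1 \<le> P z" using Q_ge_1[OF z, of N] Q_ge_1[OF z, of "Suc N"] M by (simp add: P_def)
  have G0: "G dens0 = 1" by (simp add: ip_dens0 psi_def)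
  \<comment> \<open>Payments made earlier are allowed to grow by the factor \<open>z\<close> in each step as well.\<close>
  have "P z * (1 - G (?h n)) + ip (?h n) (psi z) \<le> z ^ n \<and> 0 \<le> 1 - G (?h n)"
  proof (induction n)
    case 0
    then show ?case by (simp add: ip_dens0 psi_def)
  next
    case (Suc n)
    have "0 \<le> flux (?h n)" by (intro flux_nonneg decr_dens)
    then have "0 \<le> 1 - G (?h (Suc n))" using Suc by (simp add: G_step)
    moreover have "P z * (1 - G (?h (Suc n))) + ip (?h (Suc n)) (psi z)
        = P z * (1 - G (?h n)) + z * ip (?h n) (psi z)"
      by (simp add: G_step ip_psi_step[of _ z] algebra_simps)
    moreover have "1 * (P z * (1 - G (?h n))) \<le> z * (P z * (1 - G (?h n)))"
      using Suc P z by (intro mult_right_mono mult_nonneg_nonneg) auto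
    moreover have "z * (P z * (1 - G (?h n)) + ip (?h n) (psi z)) \<le> z ^ Suc n"
      using Suc z by (simp add: mult_left_mono)
    ultimately show ?case by (simp add: distrib_left)
  qed
  moreover have "0 \<le> ip (?h n) (psi z)"
    unfolding ip_fold using Q_ge_1[OF z] M
    by (intro sum_nonneg mult_nonneg_nonneg[OF fold_nonneg] decr_dens) (auto intro: order.trans[of 0 1])
  ultimately have "P z * (1 - G (?h n)) \<le> z ^ n" by linarith
  then show ?thesis using P by (simp add: pos_le_divide_eq mult.commute)
qed

lemma decr_psi_1: "decr (psi 1)"
  by (auto simp: decr_def psi_def poly_bd_poly_1)

lemma psi_pow_reflect: "x \<le> M \<Longrightarrow> (kop ^^ n) (psi z) (M - x) = - (kop ^^ n) (psi z) x"
proof (induction n arbitrary: x)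
  case (Suc n)
  let ?f = "(kop ^^ n) (psi z)"
  have "kop ?f (M - x) = kop (\<lambda>y. - ?f y) x"
    unfolding kop_reflect[OF Suc.prems] using Suc.IH by (intro kop_cong[THEN fun_cong]) auto
  then show ?case by (simp add: kop_def[of _ x] sum_negf)
qed (simp add: psi_reflect)

text \<open>
  Started from equilibrium, the antisymmetric part relaxes at rate \<open>z\<close> without the large factor
  \<open>1 / P z\<close>: the iterates of \<open>psi 1\<close> and \<open>Q\<close> are both decreasing, so Chebyshev's sum
  inequality bounds the product of their averages by the average of their product, which decays as
  \<open>z ^ n\<close>.
\<close>

lemma average_decay:
  assumes P: "\<And>y. z \<le> y \<Longrightarrow> y \<le> 1 \<Longrightarrow> 0 < P y" and z: "0 \<le> z" "z \<le> 1"
  shows "(\<Sum>x\<le>N. \<pi> x * (kop ^^ n) (psi 1) x) \<le> z ^ n / 2"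
proof -
  let ?g = "(kop ^^ n) (psi 1)"
  have ip2: "ip ((kop ^^ m) (psi 1)) (psi z) = 2 * (\<Sum>x\<le>N. \<pi> x * (kop ^^ m) (psi 1) x * Q x z)" for m
    unfolding ip_fold sum_distrib_left
    by (intro sum.cong refl) (simp add: psi_pow_reflect less_imp_le[OF left_less] algebra_simps)
  have S: "(\<Sum>x\<le>N. \<pi> x * psi 1 x * Q x z) = (\<Sum>x\<le>N. \<pi> x * Q x z)"
    by (intro sum.cong refl) (simp add: psi_def poly_bd_poly_1)
  have Spos: "0 < (\<Sum>x\<le>N. \<pi> x * Q x z)"
    using pi_pos Q_pos[OF P z(2)] M by (intro sum_pos mult_pos_pos) auto
  have Qdec: "Q y z \<le> Q x z" if "x \<le> y" "y \<le> N" for x y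
    using that
  proof (induction y rule: dec_induct)
    case (step n)
    then have "Q (Suc n) z \<le> Q n z" by (intro Q_ge_P(2)[OF P z(2)]) auto
    with step show ?case by simp
  qed simp
  have "(\<Sum>x\<le>N. \<pi> x * ?g x) * (\<Sum>x\<le>N. \<pi> x * Q x z)
      \<le> (\<Sum>x\<le>N. \<pi> x) * (\<Sum>x\<le>N. \<pi> x * ?g x * Q x z)"
    using pi_nonneg M Qdec decrD[OF decr_kop_pow[OF decr_psi_1, of n]]
    by (intro Chebyshev_sum_weighted) auto
  also have "\<dots> = ip ?g (psi z) / 4" unfolding ip2 pi_half by simp
  also have "\<dots> \<le> z ^ n * ip (psi 1) (psi z) / 4"
    using ip_psi_decay[OF decr_psi_1 z(1), of n] P[of z] z by (simp add: less_imp_le)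
  also have "ip (psi 1) (psi z) = 2 * (\<Sum>x\<le>N. \<pi> x * Q x z)"
    using ip2[of 0] S by simp
  finally have "(\<Sum>x\<le>N. \<pi> x * ?g x) * (\<Sum>x\<le>N. \<pi> x * Q x z)
     \<le> (z ^ n / 2) * (\<Sum>x\<le>N. \<pi> x * Q x z)" by simp
  then show ?thesis using Spos by (simp add: mult_le_cancel_right)
qed

section \<open>Total variation and the mass difference of the two halves\<close>

lemma chain_law_nonneg: "x \<le> M \<Longrightarrow> 0 \<le> chain_law M K 0 n x"
  by (induction n arbitrary: x) (auto intro!: sum_nonneg mult_nonneg_nonneg K_nonneg)

lemma chain_law_sum: "(\<Sum>x\<le>M. chain_law M K 0 n x) = 1"
proof (induction n)
  case (Suc n)
  have "(\<Sum>y\<le>M. chain_law M K 0 (Suc n) y) = (\<Sum>x\<le>M. chain_law M K 0 n x * (\<Sum>y\<le>M. K x y))"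
    by (simp add: sum_distrib_left) (rule sum.swap)
  also have "\<dots> = (\<Sum>x\<le>M. chain_law M K 0 n x)" by (intro sum.cong refl) (simp add: K_sum)
  finally show ?case using Suc by simp
qed simp

text \<open>
  Compare the decreasing density \<open>h\<close> with its value \<open>h N\<close> in the middle: it lies above on the left
  half and below on the right half, so the total deviation from \<open>h N\<close> is the mass difference \<open>G\<close>; and
  \<open>h N\<close>, being between the averages \<open>1 + G\<close> and \<open>1 - G\<close> of the two halves, is within \<open>G\<close> of \<open>1\<close>.
\<close>

lemma tv_le_2G: "tv_dist M (chain_law M K 0 n) \<pi> \<le> 2 * G ((kop ^^ n) dens0)"
proof -
  define h where "h = (kop ^^ n) dens0"
  have dh: "decr h" unfolding h_def by (rule decr_dens)
  have law: "chain_law M K 0 n x = \<pi> x * h x" if "x \<le> M" for x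
    using chain_law_dens[OF that] by (simp add: h_def)
  have pr: "\<pi> (M - x) = \<pi> x" if "x \<le> N" for x using pi_sym left_less[OF that] by simp
  have left: "h N \<le> h x" "h (M - x) \<le> h N" if "x \<le> N" for x
  proof -
    show "h N \<le> h x" using decrD[OF dh that] left_less[of N] by simp
    have "N \<le> M - x" "M - x \<le> M" using that M by auto
    then show "h (M - x) \<le> h N" by (rule decrD[OF dh])
  qed
  have "(\<Sum>x\<le>M. \<pi> x * h x) = 1" using chain_law_sum[of n] law by simp
  then have total: "(\<Sum>x\<le>N. \<pi> x * h x) + (\<Sum>x\<le>N. \<pi> x * h (M - x)) = 1"
    unfolding sum_fold[OF M] by (simp add: pr sum.distrib)
  have diff: "(\<Sum>x\<le>N. \<pi> x * h x) - (\<Sum>x\<le>N. \<pi> x * h (M - x)) = G h"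
    unfolding ip_fold by (simp add: poly_bd_poly_1 right_diff_distrib sum_subtractf)
  have "(\<Sum>x\<le>N. \<pi> x * h N) \<le> (\<Sum>x\<le>N. \<pi> x * h x)"
    using left pi_nonneg left_less by (intro sum_mono mult_left_mono) (auto simp: less_imp_le)
  moreover have "(\<Sum>x\<le>N. \<pi> x * h (M - x)) \<le> (\<Sum>x\<le>N. \<pi> x * h N)"
    using left pi_nonneg left_less by (intro sum_mono mult_left_mono) (auto simp: less_imp_le)
  moreover have half: "(\<Sum>x\<le>N. \<pi> x * c) = c / 2" for c
    using pi_half by (simp flip: sum_distrib_right)
  ultimately have mid: "\<bar>h N - 1\<bar> \<le> G h" using total diff by (simp add: abs_le_iff)
  have "(\<Sum>x\<le>M. \<pi> x * \<bar>h x - 1\<bar>) = (\<Sum>x\<le>N. \<pi> x * (\<bar>h x - 1\<bar> + \<bar>h (M - x) - 1\<bar>))"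
    unfolding sum_fold[OF M] by (intro sum.cong refl) (simp add: pr distrib_left)
  also have "\<dots> \<le> (\<Sum>x\<le>N. \<pi> x * (h x - h (M - x) + 2 * \<bar>h N - 1\<bar>))"
  proof (intro sum_mono mult_left_mono)
    fix x assume "x \<in> {..N}"
    moreover have "\<bar>a - 1\<bar> + \<bar>b - 1\<bar> \<le> a - b + 2 * \<bar>m - 1\<bar>" if "m \<le> a" "b \<le> m" for a b m :: real
      using that by (simp add: abs_if)
    ultimately show "\<bar>h x - 1\<bar> + \<bar>h (M - x) - 1\<bar> \<le> h x - h (M - x) + 2 * \<bar>h N - 1\<bar>"
      using left[of x] by simp
  qed (use pi_nonneg left_less in \<open>auto simp: less_imp_le\<close>)
  also have "\<dots> = G h + \<bar>h N - 1\<bar>"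
    unfolding distrib_left right_diff_distrib sum.distrib sum_subtractf half diff by simp
  finally have L1: "(\<Sum>x\<le>M. \<pi> x * \<bar>h x - 1\<bar>) \<le> 2 * G h" using mid by simp
  have "\<bar>sum (chain_law M K 0 n) A - sum \<pi> A\<bar> \<le> 2 * G h" if "A \<subseteq> {..M}" for A
  proof -
    have "\<bar>sum (chain_law M K 0 n) A - sum \<pi> A\<bar> \<le> (\<Sum>x\<in>A. \<bar>chain_law M K 0 n x - \<pi> x\<bar>)"
      unfolding sum_subtractf[symmetric] by (rule sum_abs)
    also have "\<dots> = (\<Sum>x\<in>A. \<pi> x * \<bar>h x - 1\<bar>)"
    proof (intro sum.cong refl)
      fix x assume "x \<in> A"
      then have x: "x \<le> M" using that by auto
      have "chain_law M K 0 n x - \<pi> x = \<pi> x * (h x - 1)"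
        by (simp add: law[OF x] algebra_simps)
      then show "\<bar>chain_law M K 0 n x - \<pi> x\<bar> = \<pi> x * \<bar>h x - 1\<bar>"
        using pi_nonneg[OF x] by (simp add: abs_mult)
    qed
    also have "\<dots> \<le> (\<Sum>x\<le>M. \<pi> x * \<bar>h x - 1\<bar>)"
      using that pi_nonneg by (intro sum_mono2) auto
    finally show ?thesis using L1 by simp
  qed
  then show ?thesis unfolding tv_dist_def h_def by (intro Max.boundedI) auto
qed

lemma tv_ge_event: "A \<subseteq> {..M} \<Longrightarrow> sum (chain_law M K 0 n) A - sum \<pi> A \<le> tv_dist M (chain_law M K 0 n) \<pi>"
  unfolding tv_dist_def
  by (rule order.trans[OF abs_ge_self], rule Max_ge) auto

lemma tv_nonneg: "0 \<le> tv_dist M (chain_law M K 0 n) \<pi>"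
  using tv_ge_event[of "{}" n] by simp

lemma tv_le_1: "tv_dist M (chain_law M K 0 n) \<pi> \<le> 1"
proof -
  have "\<bar>sum (chain_law M K 0 n) A - sum \<pi> A\<bar> \<le> 1" if "A \<subseteq> {..M}" for A
  proof -
    have "0 \<le> sum (chain_law M K 0 n) A" "0 \<le> sum \<pi> A"
      using that chain_law_nonneg pi_nonneg by (auto intro!: sum_nonneg)
    moreover have "sum (chain_law M K 0 n) A \<le> sum (chain_law M K 0 n) {..M}" "sum \<pi> A \<le> sum \<pi> {..M}"
      using that chain_law_nonneg pi_nonneg by (auto intro!: sum_mono2)
    ultimately show ?thesis using chain_law_sum[of n] pi_sum by simp
  qed
  then show ?thesis unfolding tv_dist_def by (intro Max.boundedI) auto
qed

lemma psi_pow_le_1: "x \<le> M \<Longrightarrow> (kop ^^ n) (psi 1) x \<le> 1"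
proof (induction n arbitrary: x)
  case 0
  then show ?case by (simp add: psi_def poly_bd_poly_1)
next
  case (Suc n)
  have "kop ((kop ^^ n) (psi 1)) x \<le> (\<Sum>y\<le>M. K x y * 1)"
    unfolding kop_def[of "(kop ^^ n) (psi 1)"] using Suc K_nonneg by (intro sum_mono mult_left_mono) auto
  then show ?case using K_sum[OF Suc.prems] by simp
qed

lemma psi_pow_nonneg: assumes "x \<le> N" shows "0 \<le> (kop ^^ n) (psi 1) x"
proof -
  have "(kop ^^ n) (psi 1) (M - x) \<le> (kop ^^ n) (psi 1) x"
    by (rule decrD[OF decr_kop_pow[OF decr_psi_1]]) (use left_le_reflect[OF assms] in auto)
  then show ?thesis using psi_pow_reflect[of x n 1] left_less[OF assms] by simp
qed

text \<open>
  The measure \<open>m = min \<mu> \<pi>\<close> has mass \<open>1 - tv_dist\<close>. After \<open>s\<close> more steps, \<open>\<mu>\<close> has at least the mass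
  on the right that \<open>m\<close> has, while \<open>m \<le> \<pi>\<close> bounds the imbalance of \<open>m\<close> by that of \<open>\<pi>\<close>
  restricted to the left half.
\<close>

lemma overlap_bound:
  "1 - tv_dist M (chain_law M K 0 n) \<pi>
    \<le> (1 - G ((kop ^^ (n + s)) dens0)) + (\<Sum>x\<le>N. \<pi> x * (kop ^^ s) (psi 1) x)"
proof -
  let ?\<mu> = "chain_law M K 0 n"
  define g where "g = (kop ^^ s) (psi 1)"
  define m where "m x = min (?\<mu> x) (\<pi> x)" for x
  define A where "A = {x. x \<le> M \<and> \<pi> x \<le> ?\<mu> x}"
  have "(\<Sum>x\<le>M. ?\<mu> x - m x) = (\<Sum>x\<in>A. ?\<mu> x - \<pi> x)"
    by (rule sum.mono_neutral_cong_right) (auto simp: A_def m_def min_def)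
  also have "\<dots> \<le> tv_dist M ?\<mu> \<pi>"
    unfolding sum_subtractf by (rule tv_ge_event) (auto simp: A_def)
  finally have "1 - tv_dist M ?\<mu> \<pi> \<le> (\<Sum>x\<le>M. m x)"
    by (simp add: sum_subtractf chain_law_sum)
  also have "\<dots> = (\<Sum>x\<le>M. m x * (1 - g x)) + (\<Sum>x\<le>M. m x * g x)"
    by (simp add: algebra_simps sum_subtractf)
  also have "(\<Sum>x\<le>M. m x * (1 - g x)) \<le> (\<Sum>x\<le>M. ?\<mu> x * (1 - g x))"
    using psi_pow_le_1 by (intro sum_mono mult_right_mono) (auto simp: m_def g_def)
  also have "\<dots> = 1 - (\<Sum>x\<le>M. ?\<mu> x * g x)"
    by (simp add: right_diff_distrib sum_subtractf chain_law_sum)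
  also have "(\<Sum>x\<le>M. ?\<mu> x * g x) = ip ((kop ^^ n) dens0) g"
    unfolding ip_def by (intro sum.cong refl) (simp add: chain_law_dens)
  also have "\<dots> = G ((kop ^^ (n + s)) dens0)"
    unfolding g_def ip_kop_pow by (simp add: funpow_add)
  also have "(\<Sum>x\<le>M. m x * g x) \<le> (\<Sum>x\<le>N. \<pi> x * g x)"
    unfolding sum_fold[OF M]
  proof (intro sum_mono)
    fix x assume "x \<in> {..N}"
    then have x: "x \<le> N" "x \<le> M" using left_less[of x] by auto
    have g0: "0 \<le> g x" unfolding g_def by (rule psi_pow_nonneg[OF x(1)])
    have "0 \<le> m (M - x)" unfolding m_def using chain_law_nonneg pi_nonneg by simp
    then have "0 \<le> m (M - x) * g x" using g0 by simp
    moreover have "m x * g x \<le> \<pi> x * g x" using g0 by (intro mult_right_mono) (auto simp: m_def)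
    moreover have "g (M - x) = - g x" unfolding g_def by (rule psi_pow_reflect[OF x(2)])
    ultimately show "m x * g x + m (M - x) * g (M - x) \<le> \<pi> x * g x" by simp
  qed
  finally show ?thesis by (simp add: g_def)
qed

section \<open>Eigenvalues and the middle edge\<close>

lemma eigenfunction_unique:
  assumes f: "\<And>x. x \<le> M \<Longrightarrow> kop f x = l * f x" and x: "x \<le> M"
  shows "f x = f 0 * Q x l"
  using x
proof (induction x rule: less_induct)
  case (less x)
  show ?case
  proof (cases x)
    case (Suc y)
    then have y: "y < M" "y \<le> M" using less.prems by auto
    have IH: "f y = f 0 * Q y l" "f (y - 1) = f 0 * Q (y - 1) l"
      using less.IH[of y] less.IH[of "y - 1"] Suc y by auto
    have "K y (Suc y) * (f (Suc y) - f y) = (l - 1) * f y + K y (y - 1) * (f y - f (y - 1))"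
      using f[OF y(2)] unfolding kop_interior[OF y(1)] by (simp add: algebra_simps)
    also have "\<dots> = f 0 * (K y (Suc y) * (Q (Suc y) l - Q y l))"
      unfolding Q_rec[OF y(1)] IH by (simp add: algebra_simps)
    finally have "K y (Suc y) * (f (Suc y) - f y) = K y (Suc y) * (f 0 * Q (Suc y) l - f y)"
      unfolding IH by (simp add: algebra_simps)
    then show ?thesis using up_pos[OF y(1)] Suc by simp
  qed simp
qed

lemma eigenvalueE:
  assumes "eigenvalue (kernel_mat M K) l"
  obtains f where "\<And>x. x \<le> M \<Longrightarrow> kop f x = l * f x" "f 0 \<noteq> 0"
proof -
  obtain v where v: "v \<in> carrier_vec (M + 1)" "v \<noteq> 0\<^sub>v (M + 1)" "kernel_mat M K *\<^sub>v v = l \<cdot>\<^sub>v v"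
    using assms by (auto simp: eigenvalue_def eigenvector_def kernel_mat_def)
  define f where "f x = v $ x" for x
  have f: "kop f x = l * f x" if "x \<le> M" for x
  proof -
    have "(kernel_mat M K *\<^sub>v v) $ x = (\<Sum>y\<in>{0..<M + 1}. K x y * f y)"
      using v(1) that by (simp add: kernel_mat_def scalar_prod_def f_def)
    also have "{0..<M + 1} = {..M}" by auto
    finally show ?thesis using v that by (simp add: kop_def f_def)
  qed
  have "f 0 \<noteq> 0"
  proof
    assume "f 0 = 0"
    then have "v $ x = 0" if "x \<le> M" for x
      using eigenfunction_unique[OF f that] by (simp add: f_def)
    then have "v = 0\<^sub>v (M + 1)" using v(1) by (intro eq_vecI) auto
    then show False using v by simp
  qed
  with f show ?thesis using that by blast
qed

text \<open>
  By uniqueness the reflected eigenfunction is a multiple of the eigenfunction, and the factor is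
  \<open>1\<close> or \<open>-1\<close> since reflecting twice is the identity.
\<close>

lemma eigenvalue_middle:
  assumes "eigenvalue (kernel_mat M K) l"
  shows "Q (Suc N) l = Q N l \<or> Q (Suc N) l = - Q N l"
proof -
  obtain f where f: "\<And>x. x \<le> M \<Longrightarrow> kop f x = l * f x" "f 0 \<noteq> 0"
    using eigenvalueE[OF assms] by blast
  have r: "f (M - x) = f M * Q x l" if "x \<le> M" for x
    using eigenfunction_unique[of "\<lambda>y. f (M - y)" l x] f(1) that
    by (simp add: kop_reflect[symmetric])
  have Q: "f x = f 0 * Q x l" if "x \<le> M" for x using eigenfunction_unique[OF f(1) that] .
  have "f 0 = f M * Q M l" using r[of M] by simp
  then have "f 0 * 1 = f 0 * (Q M l * Q M l)" using Q[of M] by simp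
  then have "Q M l * Q M l = 1" using f(2) by (simp only: mult_cancel_left) simp
  then have "(Q M l - 1) * (Q M l + 1) = 0" by (simp add: algebra_simps)
  then have "Q M l = 1 \<or> Q M l = -1" by auto
  moreover have "f 0 * Q (Suc N) l = f 0 * (Q M l * Q N l)"
    using r[of N] Q[of "Suc N"] Q[of M] left_less[of N] by (auto simp: middle)
  ultimately show ?thesis using f(2) by auto
qed

lemma eigenvalue_abs_le_1:
  assumes "eigenvalue (kernel_mat M K) l"
  shows "\<bar>l\<bar> \<le> 1"
proof -
  obtain f where f: "\<And>x. x \<le> M \<Longrightarrow> kop f x = l * f x" "f 0 \<noteq> 0"
    using eigenvalueE[OF assms] by blast
  have "Max ((\<lambda>x. \<bar>f x\<bar>) ` {..M}) \<in> (\<lambda>x. \<bar>f x\<bar>) ` {..M}" by (intro Max_in) auto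
  then obtain x where "x \<in> {..M}" and x2: "Max ((\<lambda>x. \<bar>f x\<bar>) ` {..M}) = \<bar>f x\<bar>"
    by (rule imageE)
  then have x: "x \<le> M" by simp
  have le: "\<bar>f y\<bar> \<le> \<bar>f x\<bar>" if "y \<le> M" for y
    unfolding x2[symmetric] using that by (intro Max_ge) auto
  have "\<bar>l\<bar> * \<bar>f x\<bar> = \<bar>kop f x\<bar>" using f(1)[OF x] by (simp add: abs_mult)
  also have "\<dots> \<le> (\<Sum>y\<le>M. K x y * \<bar>f y\<bar>)"
    unfolding kop_def using K_nonneg[OF x]
    by (intro order.trans[OF sum_abs] sum_mono) (auto simp: abs_mult)
  also have "\<dots> \<le> (\<Sum>y\<le>M. K x y * \<bar>f x\<bar>)"
    using K_nonneg[OF x] le by (intro sum_mono mult_left_mono) auto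
  also have "\<dots> = 1 * \<bar>f x\<bar>" using K_sum[OF x] by (simp flip: sum_distrib_right)
  finally have "\<bar>l\<bar> * \<bar>f x\<bar> \<le> 1 * \<bar>f x\<bar>" .
  moreover have "0 < \<bar>f x\<bar>" using le[of 0] f(2) by linarith
  ultimately show ?thesis by (simp only: mult_le_cancel_right_pos)
qed

end

section \<open>Interlacing and the product formula\<close>

locale sym_bd_spectrum = sym_bd_chain +
  fixes lam :: "nat \<Rightarrow> real"
  assumes eig: "{l. eigenvalue (kernel_mat M K) l} = lam ` {0..M}"
    and lam_0: "lam 0 = 1"
    and lam_decr: "i < j \<Longrightarrow> j \<le> M \<Longrightarrow> lam j < lam i"
begin

lemma lam_less_iff: "i \<le> M \<Longrightarrow> j \<le> M \<Longrightarrow> lam i < lam j \<longleftrightarrow> j < i"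
  using lam_decr[of i j] lam_decr[of j i] by (cases i j rule: linorder_cases) auto

lemma inj_lam: "inj_on lam {..M}"
proof (rule inj_onI)
  fix i j assume "i \<in> {..M}" "j \<in> {..M}" "lam i = lam j"
  then show "i = j" using lam_less_iff[of i j] lam_less_iff[of j i] by auto
qed

text \<open>
  Its roots are the eigenvalues whose eigenfunction is antisymmetric under \<open>x \<mapsto> M - x\<close>;
  those of \<open>sym_poly\<close> below have a symmetric eigenfunction.
\<close>

definition antisym_poly :: "real poly" where "antisym_poly = bd_poly K (Suc N) + bd_poly K N"
definition sym_poly :: "real poly" where "sym_poly = bd_poly K (Suc N) - bd_poly K N"

lemma wronskian_sym_antisym: "0 < poly (pderiv sym_poly * antisym_poly - sym_poly * pderiv antisym_poly) z"
  using wronskian_Q[of N z] left_less[of N]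
  by (simp add: antisym_poly_def sym_poly_def pderiv_add pderiv_diff algebra_simps)

lemma wronskian_antisym_sym: "0 < poly (pderiv antisym_poly * (- sym_poly) - antisym_poly * pderiv (- sym_poly)) z"
  using wronskian_sym_antisym[of z] by (simp add: pderiv_minus algebra_simps)

lemma degree_sym_antisym: "degree antisym_poly \<le> Suc N" "degree sym_poly \<le> Suc N"
  unfolding antisym_poly_def sym_poly_def using degree_bd_poly[of K N] degree_bd_poly[of K "Suc N"]
  by (auto intro!: degree_add_le degree_diff_le)

lemma sym_antisym_nonzero: "antisym_poly \<noteq> 0" "sym_poly \<noteq> 0"
  using wronskian_sym_antisym[of 0] by auto

definition antisym_indices where "antisym_indices = {k. k \<le> M \<and> poly antisym_poly (lam k) = 0}"
definition sym_indices where "sym_indices = {k. k \<le> M \<and> poly sym_poly (lam k) = 0}"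

lemma indices_cover: "antisym_indices \<union> sym_indices = {..M}"
proof -
  have "k \<in> antisym_indices \<union> sym_indices" if "k \<le> M" for k
  proof -
    have "eigenvalue (kernel_mat M K) (lam k)" using eig that by auto
    from eigenvalue_middle[OF this] show ?thesis using that
      by (auto simp: antisym_indices_def sym_indices_def antisym_poly_def sym_poly_def)
  qed
  then show ?thesis by (auto simp: antisym_indices_def sym_indices_def)
qed

lemma indices_disjoint: "antisym_indices \<inter> sym_indices = {}"
proof -
  have False if "poly antisym_poly z = 0" "poly sym_poly z = 0" for z
    using wronskian_sym_antisym[of z] that by simp
  then show ?thesis by (auto simp: antisym_indices_def sym_indices_def)
qed

lemma card_image_roots:
  assumes "p \<noteq> 0" "degree p \<le> Suc N"
  shows "card {k. k \<le> M \<and> poly p (lam k) = 0} \<le> card {x. poly p x = 0}"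
    and "card {x. poly p x = 0} \<le> Suc N"
proof -
  have "card {k. k \<le> M \<and> poly p (lam k) = 0} = card (lam ` {k. k \<le> M \<and> poly p (lam k) = 0})"
    by (rule card_image[symmetric], rule inj_on_subset[OF inj_lam]) auto
  also have "\<dots> \<le> card {x. poly p x = 0}"
    by (rule card_mono) (use poly_roots_finite[OF assms(1)] in auto)
  finally show "card {k. k \<le> M \<and> poly p (lam k) = 0} \<le> card {x. poly p x = 0}" .
  show "card {x. poly p x = 0} \<le> Suc N"
    using poly_roots_degree[OF assms(1)] assms(2) by simp
qed

text \<open>
  Each of the \<open>2N + 2\<close> distinct eigenvalues is a root of one of two polynomials of degree at most
  \<open>N + 1\<close>, so these have no other roots.
\<close>

lemma roots_are_eigenvalues: "{x. poly antisym_poly x = 0} = lam ` antisym_indices" "{x. poly sym_poly x = 0} = lam ` sym_indices"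
proof -
  have "card (antisym_indices \<union> sym_indices) = card antisym_indices + card sym_indices"
    using indices_disjoint by (intro card_Un_disjoint) (auto simp: antisym_indices_def sym_indices_def)
  then have "2 * N + 2 = card antisym_indices + card sym_indices" unfolding indices_cover using M by simp
  moreover note cU = card_image_roots[OF sym_antisym_nonzero(1) degree_sym_antisym(1), folded antisym_indices_def]
  moreover note cV = card_image_roots[OF sym_antisym_nonzero(2) degree_sym_antisym(2), folded sym_indices_def]
  ultimately have c: "card {x. poly antisym_poly x = 0} \<le> card antisym_indices" "card {x. poly sym_poly x = 0} \<le> card sym_indices"
    by linarith+
  have i: "card (lam ` antisym_indices) = card antisym_indices" "card (lam ` sym_indices) = card sym_indices"
    by (auto intro!: card_image inj_on_subset[OF inj_lam] simp: antisym_indices_def sym_indices_def)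
  show "{x. poly antisym_poly x = 0} = lam ` antisym_indices"
    by (rule card_seteq[symmetric]) (use c i poly_roots_finite[OF sym_antisym_nonzero(1)] in \<open>auto simp: antisym_indices_def\<close>)
  show "{x. poly sym_poly x = 0} = lam ` sym_indices"
    by (rule card_seteq[symmetric]) (use c i poly_roots_finite[OF sym_antisym_nonzero(2)] in \<open>auto simp: sym_indices_def\<close>)
qed

lemma no_eigenvalue_between:
  assumes "k < M" "j \<le> M" "lam (Suc k) < lam j" "lam j < lam k"
  shows False
  using assms lam_less_iff[of "Suc k" j] lam_less_iff[of j k] by auto

lemma antisym_not_consecutive:
  assumes "k < M" "k \<in> antisym_indices" "Suc k \<in> antisym_indices"
  shows False
proof -
  have "\<exists>c. lam (Suc k) < c \<and> c < lam k \<and> poly (- sym_poly) c = 0"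
    by (rule wronskian_root_between[OF wronskian_antisym_sym]) (use assms lam_decr in \<open>auto simp: antisym_indices_def\<close>)
  then obtain c where c: "lam (Suc k) < c" "c < lam k" "poly sym_poly c = 0" by auto
  then obtain j where "j \<in> sym_indices" "c = lam j" using roots_are_eigenvalues(2) by blast
  then show False using c no_eigenvalue_between[OF assms(1), of j] by (auto simp: sym_indices_def)
qed

lemma sym_not_consecutive:
  assumes "k < M" "k \<in> sym_indices" "Suc k \<in> sym_indices"
  shows False
proof -
  have "\<exists>c. lam (Suc k) < c \<and> c < lam k \<and> poly antisym_poly c = 0"
    by (rule wronskian_root_between[OF wronskian_sym_antisym]) (use assms lam_decr in \<open>auto simp: sym_indices_def\<close>)
  then obtain c where c: "lam (Suc k) < c" "c < lam k" "poly antisym_poly c = 0" by auto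
  then obtain j where "j \<in> antisym_indices" "c = lam j" using roots_are_eigenvalues(1) by blast
  then show False using c no_eigenvalue_between[OF assms(1), of j] by (auto simp: antisym_indices_def)
qed

text \<open>
  Two neighbouring eigenvalues of the same parity would have an eigenvalue of the other parity
  strictly between them; so the parities alternate, starting with the constant eigenfunction.
\<close>

lemma antisym_iff_odd: "k \<le> M \<Longrightarrow> k \<in> antisym_indices \<longleftrightarrow> odd k"
proof (induction k)
  case 0
  have "0 \<in> sym_indices" by (simp add: sym_indices_def sym_poly_def lam_0 poly_bd_poly_1)
  then show ?case using indices_disjoint by auto
next
  case (Suc k)
  then have "k \<in> antisym_indices \<union> sym_indices" "Suc k \<in> antisym_indices \<union> sym_indices" using indices_cover by auto
  moreover have "\<not> (k \<in> antisym_indices \<and> k \<in> sym_indices)" "\<not> (Suc k \<in> antisym_indices \<and> Suc k \<in> sym_indices)"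
    using indices_disjoint by blast+
  moreover have "\<not> (k \<in> antisym_indices \<and> Suc k \<in> antisym_indices)" "\<not> (k \<in> sym_indices \<and> Suc k \<in> sym_indices)"
    using antisym_not_consecutive[of k] sym_not_consecutive[of k] Suc.prems by auto
  moreover have "k \<in> antisym_indices \<longleftrightarrow> odd k" using Suc by simp
  ultimately show ?case unfolding even_Suc by blast
qed

lemma lam_less_1: "1 \<le> k \<Longrightarrow> k \<le> M \<Longrightarrow> lam k < 1"
  using lam_decr[of 0 k] lam_0 by auto

definition rel_time :: "nat \<Rightarrow> real" where "rel_time k = 1 / (1 - lam k)"

lemma P_prod: "P z = (\<Prod>j\<le>N. 1 + (z - 1) * rel_time (2 * j + 1))"
proof -
  define q where "q = Polynomial.smult 2 (\<Prod>j\<le>N. Polynomial.smult (rel_time (2 * j + 1)) [:- lam (2 * j + 1), 1:])"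
  define R where "R = (\<lambda>j. lam (2 * j + 1)) ` {..N}"
  have le: "2 * j + 1 \<le> M" if "j \<le> N" for j using that M by simp
  have lt: "lam (2 * j + 1) < 1" if "j \<le> N" for j using lam_less_1[of "2 * j + 1"] le[OF that] by simp
  have "inj_on (\<lambda>j. lam (2 * j + 1)) {..N}"
  proof (rule inj_onI)
    fix i j assume ij: "i \<in> {..N}" "j \<in> {..N}" "lam (2 * i + 1) = lam (2 * j + 1)"
    then have "2 * i + 1 = 2 * j + 1" using le by (intro inj_onD[OF inj_lam]) auto
    then show "i = j" by simp
  qed
  then have "card R = Suc N" unfolding R_def by (simp add: card_image)
  moreover have "1 \<notin> R" using lt by (force simp: R_def)
  ultimately have card: "card (insert 1 R) = Suc (Suc N)" by (simp add: R_def)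
  have dq: "degree q \<le> Suc N"
  proof -
    have "degree (\<Prod>j\<le>N. Polynomial.smult (rel_time (2 * j + 1)) [:- lam (2 * j + 1), 1:])
        \<le> (\<Sum>j\<le>N. degree (Polynomial.smult (rel_time (2 * j + 1)) [:- lam (2 * j + 1), 1:]))"
      by (rule order.trans[OF degree_prod_sum_le]) (auto simp: o_def)
    also have "\<dots> \<le> (\<Sum>j\<le>N. 1)" by (intro sum_mono order.trans[OF degree_smult_le]) simp
    finally show ?thesis unfolding q_def by (intro order.trans[OF degree_smult_le]) simp
  qed
  have pq: "poly q z = 2 * (\<Prod>j\<le>N. 1 + (z - 1) * rel_time (2 * j + 1))" for z
  proof -
    have "poly (Polynomial.smult (rel_time (2 * j + 1)) [:- lam (2 * j + 1), 1:]) z = 1 + (z - 1) * rel_time (2 * j + 1)"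
      if "j \<le> N" for j
    proof -
      have "rel_time (2 * j + 1) * (1 - lam (2 * j + 1)) = 1" using lt[OF that] by (simp add: rel_time_def)
      then show ?thesis by (simp add: algebra_simps)
    qed
    then show ?thesis unfolding q_def poly_smult poly_prod
      by (intro arg_cong2[where f = "(*)"] prod.cong refl) auto
  qed
  have "antisym_poly = q"
  proof (rule poly_eqI_degree[of "insert 1 R"])
    fix x assume "x \<in> insert 1 R"
    then consider "x = 1" | j where "j \<le> N" "x = lam (2 * j + 1)" by (auto simp: R_def)
    then show "poly antisym_poly x = poly q x"
    proof cases
      case 1
      then show ?thesis by (simp add: pq) (simp add: antisym_poly_def poly_bd_poly_1)
    next
      case 2
      have "2 * j + 1 \<in> antisym_indices" using antisym_iff_odd le 2 by simp
      then have "poly antisym_poly x = 0" using 2 by (simp add: antisym_indices_def)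
      moreover have "poly q x = 0" unfolding q_def using 2 by (auto simp: poly_prod)
      ultimately show ?thesis by simp
    qed
  qed (use degree_sym_antisym dq card in auto)
  moreover have "2 * P z = poly antisym_poly z" by (simp add: P_def antisym_poly_def)
  ultimately show ?thesis using pq[of z] by simp
qed

lemma rel_time_mono: "1 \<le> i \<Longrightarrow> i \<le> j \<Longrightarrow> j \<le> M \<Longrightarrow> rel_time j \<le> rel_time i"
  using lam_decr[of i j] lam_less_1[of i] lam_less_1[of j]
  by (cases "i = j") (auto simp: rel_time_def intro!: divide_left_mono)

lemma rel_time_pos: "1 \<le> k \<Longrightarrow> k \<le> M \<Longrightarrow> 0 < rel_time k"
  using lam_less_1[of k] by (simp add: rel_time_def)

definition cutoff_time :: real where "cutoff_time = 1 / 2 * (\<Sum>k = 1..M. rel_time k)"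

definition odd_sum :: real where "odd_sum = (\<Sum>j\<le>N. rel_time (2 * j + 1))"

text \<open>
  Since \<open>rel_time\<close> decreases, each even term lies between the two adjacent odd terms; the sums over
  odd and over even indices therefore differ by at most the first term.
\<close>

lemma odd_sum_bounds: "odd_sum \<le> cutoff_time + rel_time 1 / 2" "cutoff_time \<le> odd_sum"
proof -
  have split: "(\<Sum>k = 1..2 * n + 1. rel_time k) = (\<Sum>j\<le>n. rel_time (2 * j + 1)) + (\<Sum>j<n. rel_time (2 * j + 2))" for n
    by (induction n) (auto simp: algebra_simps)
  have 2: "2 * cutoff_time = odd_sum + (\<Sum>j<N. rel_time (2 * j + 2))"
    using split[of N] unfolding cutoff_time_def odd_sum_def M[symmetric] by simp
  have "(\<Sum>j<N. rel_time (2 * j + 2)) \<le> (\<Sum>j<N. rel_time (2 * j + 1))"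
    by (intro sum_mono rel_time_mono) (use M in auto)
  also have "\<dots> \<le> odd_sum" unfolding odd_sum_def
    by (rule sum_mono2) (use M in \<open>auto intro: order.strict_implies_order[OF rel_time_pos]\<close>)
  finally show "cutoff_time \<le> odd_sum" using 2 by simp
  have "odd_sum = rel_time 1 + (\<Sum>j<N. rel_time (2 * j + 3))"
    unfolding odd_sum_def lessThan_Suc_atMost[symmetric] sum.lessThan_Suc_shift by (simp add: numeral_3_eq_3)
  also have "(\<Sum>j<N. rel_time (2 * j + 3)) \<le> (\<Sum>j<N. rel_time (2 * j + 2))"
    by (intro sum_mono rel_time_mono) (use M in auto)
  finally show "odd_sum \<le> cutoff_time + rel_time 1 / 2" using 2 by simp
qed

section \<open>Quantitative bounds and the cutoff\<close>

abbreviation gap :: real where "gap \<equiv> 1 - lam 1"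

lemma gap_bounds: "0 < gap" "gap \<le> 2"
proof -
  show "0 < gap" using lam_less_1[of 1] M by simp
  have "eigenvalue (kernel_mat M K) (lam 1)" using eig M by auto
  then show "gap \<le> 2" using eigenvalue_abs_le_1 by fastforce
qed

lemma rel_time_1: "rel_time (Suc 0) = 1 / (1 - lam (Suc 0))" by (simp add: rel_time_def)

lemma rel_time_odd: "j \<le> N \<Longrightarrow> 0 < rel_time (2 * j + 1)" "j \<le> N \<Longrightarrow> rel_time (2 * j + 1) \<le> rel_time 1"
  using M by (auto intro!: rel_time_pos rel_time_mono)

lemma P_pos:
  assumes "lam 1 < z"
  shows "0 < P z"
  unfolding P_prod
proof (intro prod_pos)
  fix j assume "j \<in> {..N}"
  then have r: "0 < rel_time (2 * j + 1)" "rel_time (2 * j + 1) \<le> rel_time 1" using rel_time_odd by auto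
  have "(1 - z) * rel_time (2 * j + 1) < gap * rel_time (2 * j + 1)"
    using assms r by (intro mult_strict_right_mono) auto
  also have "\<dots> \<le> gap * rel_time 1" using r gap_bounds by (intro mult_left_mono) auto
  also have "\<dots> = 1" using gap_bounds by (simp add: rel_time_1)
  finally show "0 < 1 + (z - 1) * rel_time (2 * j + 1)" by (simp add: algebra_simps)
qed

text \<open>
  The relaxation times add up to \<open>odd_sum\<close> and none exceeds the first, so \<open>ln (1 - y) \<ge> - y - 2 y\<^sup>2\<close>
  applied to each factor leaves an error relative to the main term of only \<open>2 v * rel_time 1\<close>.
\<close>

lemma P_lower_left:
  assumes "0 \<le> v" "v * rel_time 1 \<le> 1 / 2"
  shows "exp (- (v * odd_sum * (1 + 2 * (v * rel_time 1)))) \<le> P (1 - v)"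
proof -
  have "exp (- (v * odd_sum * (1 + 2 * (v * rel_time 1))))
      = (\<Prod>j\<le>N. exp (- (v * rel_time (2 * j + 1) * (1 + 2 * (v * rel_time 1)))))"
    by (simp add: exp_sum[symmetric] odd_sum_def sum_distrib_left sum_distrib_right sum_negf)
  also have "\<dots> \<le> (\<Prod>j\<le>N. 1 + ((1 - v) - 1) * rel_time (2 * j + 1))"
  proof (intro prod_mono conjI)
    fix j assume "j \<in> {..N}"
    then have r: "0 < rel_time (2 * j + 1)" "rel_time (2 * j + 1) \<le> rel_time 1" using rel_time_odd by auto
    define y where "y = v * rel_time (2 * j + 1)"
    have y: "0 \<le> y" "y \<le> v * rel_time 1"
      using assms r by (auto simp: y_def intro!: mult_left_mono)
    have "y * y \<le> y * (v * rel_time 1)" using y by (intro mult_left_mono) auto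
    then have "- (y * (1 + 2 * (v * rel_time 1))) \<le> - y - 2 * y\<^sup>2"
      by (simp add: power2_eq_square algebra_simps)
    also have "\<dots> \<le> ln (1 - y)"
      using y assms by (intro ln_one_minus_pos_lower_bound) auto
    finally have "exp (- (y * (1 + 2 * (v * rel_time 1)))) \<le> 1 - y"
      using y assms by (simp add: ln_ge_iff)
    then show "exp (- (v * rel_time (2 * j + 1) * (1 + 2 * (v * rel_time 1)))) \<le> 1 + ((1 - v) - 1) * rel_time (2 * j + 1)"
      by (simp add: y_def)
  qed simp
  finally show ?thesis by (simp add: P_prod)
qed

lemma P_lower_right:
  assumes "0 \<le> v" "v * rel_time 1 \<le> 1"
  shows "exp (v * odd_sum * (1 - v * rel_time 1)) \<le> P (1 + v)"
proof -
  have "exp (v * odd_sum * (1 - v * rel_time 1)) = (\<Prod>j\<le>N. exp (v * rel_time (2 * j + 1) * (1 - v * rel_time 1)))"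
    by (simp add: exp_sum[symmetric] odd_sum_def sum_distrib_left sum_distrib_right)
  also have "\<dots> \<le> (\<Prod>j\<le>N. 1 + ((1 + v) - 1) * rel_time (2 * j + 1))"
  proof (intro prod_mono conjI)
    fix j assume "j \<in> {..N}"
    then have r: "0 < rel_time (2 * j + 1)" "rel_time (2 * j + 1) \<le> rel_time 1" using rel_time_odd by auto
    define y where "y = v * rel_time (2 * j + 1)"
    have y: "0 \<le> y" "y \<le> v * rel_time 1"
      using assms r by (auto simp: y_def intro!: mult_left_mono)
    have "y * y \<le> y * (v * rel_time 1)" using y by (intro mult_left_mono) auto
    then have "y * (1 - v * rel_time 1) \<le> y - y\<^sup>2"
      by (simp add: power2_eq_square algebra_simps)
    also have "\<dots> \<le> ln (1 + y)"
      using y assms by (intro ln_one_plus_pos_lower_bound) auto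
    finally have "exp (y * (1 - v * rel_time 1)) \<le> 1 + y"
      using y by (simp add: ln_ge_iff)
    then show "exp (v * rel_time (2 * j + 1) * (1 - v * rel_time 1)) \<le> 1 + ((1 + v) - 1) * rel_time (2 * j + 1)"
      by (simp add: y_def)
  qed simp
  finally show ?thesis by (simp add: P_prod)
qed

lemma cutoff_time_pos: "0 < cutoff_time"
proof -
  have "0 < (\<Sum>k = 1..M. rel_time k)" using M by (intro sum_pos rel_time_pos) auto
  then show ?thesis by (simp add: cutoff_time_def)
qed

lemma tv_upper:
  fixes \<theta> c w :: real
  assumes w: "w = gap * cutoff_time" and \<theta>: "0 < \<theta>" "\<theta> \<le> w / 2"
  shows "tv_dist M (chain_law M K 0 (nat \<lfloor>c * cutoff_time\<rfloor>)) \<pi>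
    \<le> 2 * exp (- \<theta> * c + 2 * \<theta> / w + \<theta> * (1 + 1 / (2 * w)) * (1 + 2 * \<theta> / w))"
proof -
  define v where "v = \<theta> / cutoff_time"
  define n where "n = nat \<lfloor>c * cutoff_time\<rfloor>"
  have w0: "0 < w" using w gap_bounds cutoff_time_pos by simp
  have vpos: "0 < v" using \<theta> cutoff_time_pos by (simp add: v_def)
  have vr: "v * rel_time 1 = \<theta> / w" by (simp add: v_def w rel_time_1)
  have vT: "v * cutoff_time = \<theta>" using cutoff_time_pos by (simp add: v_def)
  have v_le: "v \<le> gap / 2"
    using \<theta> cutoff_time_pos by (simp add: v_def w field_simps)
  have "v = \<theta> * gap / w" using gap_bounds cutoff_time_pos by (simp add: v_def w)
  also have "\<dots> \<le> 2 * \<theta> / w"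
    using \<theta> w0 gap_bounds by (intro divide_right_mono) auto
  finally have v2: "v \<le> 2 * \<theta> / w" .
  have z: "lam 1 < 1 - v" "0 \<le> 1 - v" "1 - v \<le> 1"
    using v_le vpos gap_bounds by auto
  have "c * cutoff_time - 1 \<le> real n" unfolding n_def by linarith
  then have "v * (c * cutoff_time - 1) \<le> v * real n" using vpos by (intro mult_left_mono) auto
  then have vn: "- (real n * v) \<le> - \<theta> * c + 2 * \<theta> / w"
    using vT v2 by (simp add: algebra_simps)
  have "(1 - v) ^ n \<le> exp (- v) ^ n"
    using z exp_ge_add_one_self[of "- v"] by (intro power_mono) auto
  also have "\<dots> = exp (- (real n * v))" by (simp add: exp_of_nat_mult[symmetric])
  also have "\<dots> \<le> exp (- \<theta> * c + 2 * \<theta> / w)" using vn by simp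
  finally have num: "(1 - v) ^ n \<le> exp (- \<theta> * c + 2 * \<theta> / w)" .
  have "v * odd_sum \<le> v * (cutoff_time + rel_time 1 / 2)" using odd_sum_bounds vpos by (intro mult_left_mono) auto
  also have "\<dots> = \<theta> * (1 + 1 / (2 * w))" using vT vr by (simp add: distrib_left)
  finally have vS: "v * odd_sum * (1 + 2 * (v * rel_time 1)) \<le> \<theta> * (1 + 1 / (2 * w)) * (1 + 2 * \<theta> / w)"
    unfolding vr using \<theta> w0 by (auto intro!: mult_right_mono)
  have "exp (- (\<theta> * (1 + 1 / (2 * w)) * (1 + 2 * \<theta> / w))) \<le> exp (- (v * odd_sum * (1 + 2 * (v * rel_time 1))))"
    using vS by simp
  also have "\<dots> \<le> P (1 - v)"
  proof (rule P_lower_left)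
    show "v * rel_time 1 \<le> 1 / 2" unfolding vr using \<theta> w0 by (simp add: field_simps)
  qed (use vpos in simp)
  finally have den: "exp (- (\<theta> * (1 + 1 / (2 * w)) * (1 + 2 * \<theta> / w))) \<le> P (1 - v)" .
  have "G ((kop ^^ n) dens0) \<le> (1 - v) ^ n / P (1 - v)"
    using z by (intro G_upper P_pos) auto
  also have "\<dots> \<le> exp (- \<theta> * c + 2 * \<theta> / w) / exp (- (\<theta> * (1 + 1 / (2 * w)) * (1 + 2 * \<theta> / w)))"
    using num den z by (intro frac_le) auto
  also have "\<dots> = exp (- \<theta> * c + 2 * \<theta> / w + \<theta> * (1 + 1 / (2 * w)) * (1 + 2 * \<theta> / w))"
    by (simp only: exp_diff[symmetric] diff_minus_eq_add)
  finally show ?thesis using tv_le_2G[of n] by (simp add: n_def)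
qed

lemma tv_lower:
  fixes \<theta> c w :: real
  assumes w: "w = gap * cutoff_time" and \<theta>: "0 < \<theta>" "\<theta> \<le> w" and c: "0 < c"
  shows "1 - tv_dist M (chain_law M K 0 (nat \<lfloor>c * cutoff_time\<rfloor>)) \<pi>
    \<le> exp (- \<theta> * (1 - c) + 2 * \<theta>\<^sup>2 / w + 2 * \<theta> / w) + exp (- \<theta> / 2) / 2"
proof -
  define v where "v = \<theta> / cutoff_time"
  define n where "n = nat \<lfloor>c * cutoff_time\<rfloor>"
  \<comment> \<open>The extra time balances shared mass up to \<open>exp (- \<theta> / 2)\<close> but is only \<open>\<theta> / w\<close> of the cutoff time.\<close>
  define s where "s = nat \<lceil>\<theta> / gap\<rceil>"
  have w0: "0 < w" using w gap_bounds cutoff_time_pos by simp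
  have vpos: "0 < v" using \<theta> cutoff_time_pos by (simp add: v_def)
  have vr: "v * rel_time 1 = \<theta> / w" by (simp add: v_def w rel_time_1)
  have vT: "v * cutoff_time = \<theta>" using cutoff_time_pos by (simp add: v_def)
  have "v = \<theta> * gap / w" using gap_bounds cutoff_time_pos by (simp add: v_def w)
  also have "\<dots> \<le> 2 * \<theta> / w"
    using \<theta> w0 gap_bounds by (intro divide_right_mono) auto
  finally have v2: "v \<le> 2 * \<theta> / w" .
  have "0 \<le> c * cutoff_time" "0 \<le> \<theta> / gap" using c cutoff_time_pos \<theta> gap_bounds by auto
  then have ns: "real n \<le> c * cutoff_time" "\<theta> / gap \<le> real s" "real s \<le> \<theta> / gap + 1"
    unfolding n_def s_def by linarith+
  have "real (n + s) * v \<le> (c * cutoff_time + \<theta> / gap + 1) * v"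
    using ns vpos by (intro mult_right_mono) auto
  also have "\<dots> = \<theta> * c + \<theta>\<^sup>2 / w + v"
    using gap_bounds cutoff_time_pos by (simp add: v_def w power2_eq_square field_simps)
  finally have vn: "real (n + s) * v \<le> \<theta> * c + \<theta>\<^sup>2 / w + 2 * \<theta> / w" using v2 by simp
  have "(1 + v) ^ (n + s) \<le> exp v ^ (n + s)"
    using vpos by (intro power_mono) auto
  also have "\<dots> = exp (real (n + s) * v)" by (rule exp_of_nat_mult[symmetric])
  also have "\<dots> \<le> exp (\<theta> * c + \<theta>\<^sup>2 / w + 2 * \<theta> / w)" using vn by (simp only: exp_le_cancel_iff)
  finally have num: "(1 + v) ^ (n + s) \<le> exp (\<theta> * c + \<theta>\<^sup>2 / w + 2 * \<theta> / w)" .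
  have "\<theta> \<le> v * odd_sum" using odd_sum_bounds vpos vT by (metis mult_left_mono less_imp_le)
  then have "\<theta> * (1 - \<theta> / w) \<le> v * odd_sum * (1 - v * rel_time 1)"
    unfolding vr using \<theta> w0 by (intro mult_right_mono) auto
  then have "exp (\<theta> * (1 - \<theta> / w)) \<le> exp (v * odd_sum * (1 - v * rel_time 1))" by simp
  also have "\<dots> \<le> P (1 + v)"
  proof (rule P_lower_right)
    show "v * rel_time 1 \<le> 1" unfolding vr using \<theta> w0 by simp
  qed (use vpos in simp)
  finally have den: "exp (\<theta> * (1 - \<theta> / w)) \<le> P (1 + v)" .
  have "1 - G ((kop ^^ (n + s)) dens0) \<le> (1 + v) ^ (n + s) / P (1 + v)"
    using vpos by (intro G_lower) auto
  also have "\<dots> \<le> exp (\<theta> * c + \<theta>\<^sup>2 / w + 2 * \<theta> / w) / exp (\<theta> * (1 - \<theta> / w))"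
    using num den vpos by (intro frac_le) auto
  also have "\<dots> = exp (- \<theta> * (1 - c) + 2 * \<theta>\<^sup>2 / w + 2 * \<theta> / w)"
    by (simp add: exp_diff[symmetric] power2_eq_square algebra_simps)
  finally have g: "1 - G ((kop ^^ (n + s)) dens0)
      \<le> exp (- \<theta> * (1 - c) + 2 * \<theta>\<^sup>2 / w + 2 * \<theta> / w)" .
  have "(\<Sum>x\<le>N. \<pi> x * (kop ^^ s) (psi 1) x) \<le> (1 - gap / 2) ^ s / 2"
  proof (rule average_decay)
    fix y assume "1 - gap / 2 \<le> y"
    then have "lam 1 < y" using gap_bounds by (simp add: field_simps)
    then show "0 < P y" by (rule P_pos)
  qed (use gap_bounds in auto)
  also have "(1 - gap / 2) ^ s \<le> exp (- (gap / 2)) ^ s"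
    using gap_bounds exp_ge_add_one_self[of "- (gap / 2)"] by (intro power_mono) auto
  also have "\<dots> = exp (- (real s * (gap / 2)))" by (simp add: exp_of_nat_mult[symmetric])
  also have "\<dots> \<le> exp (- \<theta> / 2)"
    using ns(2) gap_bounds by (simp add: pos_divide_le_eq)
  finally have a: "(\<Sum>x\<le>N. \<pi> x * (kop ^^ s) (psi 1) x) \<le> exp (- \<theta> / 2) / 2" by simp
  show ?thesis using overlap_bound[of n s] g a by (simp add: n_def)
qed

end

theorem mainTheorem3:
  fixes K :: "nat \<Rightarrow> nat \<Rightarrow> nat \<Rightarrow> real"
    and \<pi> :: "nat \<Rightarrow> nat \<Rightarrow> real"
    and lam :: "nat \<Rightarrow> nat \<Rightarrow> real"
  assumes "\<And>N. birth_death_chain (2 * N + 1) (K N)"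
    and "\<And>N. irreducible_chain (2 * N + 1) (K N)"
    and "\<And>N. monotone_chain (2 * N + 1) (K N)"
    and "\<And>N. symmetric_chain (2 * N + 1) (K N)"
    and "\<And>N. stationary_distribution (2 * N + 1) (K N) (\<pi> N)"
    and "\<And>N. {l. eigenvalue (kernel_mat (2 * N + 1) (K N)) l} = lam N ` {0..2 * N + 1}"
    and "\<And>N. lam N 0 = 1"
    and "\<And>N i j. i < j \<Longrightarrow> j \<le> 2 * N + 1 \<Longrightarrow> lam N j < lam N i"
    and "filterlim (\<lambda>N. (1 - lam N 1) * (\<Sum>k = 1..2 * N + 1. 1 / (1 - lam N k))) at_top sequentially"
  shows "has_cutoff (\<lambda>N n. tv_dist (2 * N + 1) (chain_law (2 * N + 1) (K N) 0 n) (\<pi> N))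
           (\<lambda>N. 1 / 2 * (\<Sum>k = 1..2 * N + 1. 1 / (1 - lam N k)))"
proof -
  define t where "t N = 1 / 2 * (\<Sum>k = 1..2 * N + 1. 1 / (1 - lam N k))" for N
  define w where "w N = (1 - lam N 1) * t N" for N
  define d where "d N n = tv_dist (2 * N + 1) (chain_law (2 * N + 1) (K N) 0 n) (\<pi> N)" for N n
  interpret sym_bd_spectrum "2 * N + 1" N "K N" "\<pi> N" "lam N" for N
    by unfold_locales (use assms in auto)
  have cutoff_time: "cutoff_time N = t N" for N
    by (simp only: cutoff_time_def rel_time_def t_def)
  have "filterlim (\<lambda>N. (1 / 2) * ((1 - lam N 1) * (\<Sum>k = 1..2 * N + 1. 1 / (1 - lam N k)))) at_top sequentially"
    by (rule filterlim_tendsto_pos_mult_at_top[OF tendsto_const _ assms(9)]) simp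
  then have w: "filterlim w at_top sequentially"
    by (simp add: w_def[abs_def] t_def mult.left_commute)
  \<comment> \<open>The choice \<open>\<theta> = w powr (1 / 3)\<close> lets \<open>\<theta>\<close> tend to infinity while the error terms of order \<open>\<theta>\<^sup>2 / w\<close> vanish.\<close>
  have ev: "\<forall>\<^sub>F w :: real in at_top. 0 < w powr (1 / 3) \<and> w powr (1 / 3) \<le> w / 2"
    by (intro eventually_conj; real_asymp)
  have ev: "\<forall>\<^sub>F N in sequentially. 0 < w N powr (1 / 3) \<and> w N powr (1 / 3) \<le> w N / 2"
    using filterlim_iff[THEN iffD1, OF w] ev by blast
  have "(\<lambda>N. d N (nat \<lfloor>c * t N\<rfloor>)) \<longlonglongrightarrow> 0" if c: "1 < c" for c
  proof -
    define u where "u w = 2 * exp (- (w powr (1 / 3)) * c + 2 * w powr (1 / 3) / w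
      + w powr (1 / 3) * (1 + 1 / (2 * w)) * (1 + 2 * w powr (1 / 3) / w))" for w :: real
    have "(u \<longlongrightarrow> 0) at_top" unfolding u_def using c by real_asymp
    then have lim: "(\<lambda>N. u (w N)) \<longlonglongrightarrow> 0" by (rule filterlim_compose[OF _ w])
    have up: "\<forall>\<^sub>F N in sequentially. d N (nat \<lfloor>c * t N\<rfloor>) \<le> u (w N)"
      using ev
    proof eventually_elim
      case (elim N)
      then show ?case
        unfolding d_def u_def by (intro tv_upper[of "w N" N, unfolded cutoff_time, OF w_def]) auto
    qed
    show ?thesis
      by (rule tendsto_sandwich[OF _ up tendsto_const lim])
        (unfold d_def, intro always_eventually allI tv_nonneg)
  qed
  moreover have "(\<lambda>N. d N (nat \<lfloor>c * t N\<rfloor>)) \<longlonglongrightarrow> 1" if c: "0 < c" "c < 1" for c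
  proof -
    define e where "e = 1 - c"
    define u where "u w = 1 - (exp (- (w powr (1 / 3)) * e + 2 * (w powr (1 / 3))\<^sup>2 / w
      + 2 * w powr (1 / 3) / w) + exp (- (w powr (1 / 3)) / 2) / 2)" for w :: real
    have "0 < e" using c by (simp add: e_def)
    then have "((\<lambda>w. exp (- (w powr (1 / 3)) * e + 2 * (w powr (1 / 3))\<^sup>2 / w
      + 2 * w powr (1 / 3) / w)) \<longlongrightarrow> 0) at_top" by real_asymp
    moreover have "((\<lambda>w :: real. exp (- (w powr (1 / 3)) / 2) / 2) \<longlongrightarrow> 0) at_top" by real_asymp
    ultimately have "(u \<longlongrightarrow> 1 - (0 + 0)) at_top"
      unfolding u_def by (intro tendsto_intros)
    then have "(u \<longlongrightarrow> 1) at_top" by simp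
    then have lim: "(\<lambda>N. u (w N)) \<longlonglongrightarrow> 1" by (rule filterlim_compose[OF _ w])
    have low: "\<forall>\<^sub>F N in sequentially. u (w N) \<le> d N (nat \<lfloor>c * t N\<rfloor>)"
      using ev
    proof eventually_elim
      case (elim N)
      then have "w N powr (1 / 3) \<le> w N" by linarith
      then show ?case
        using tv_lower[of "w N" N "w N powr (1 / 3)" c, unfolded cutoff_time, OF w_def] elim c
        unfolding d_def u_def e_def by linarith
    qed
    show ?thesis
      by (rule tendsto_sandwich[OF low _ lim tendsto_const])
        (unfold d_def, intro always_eventually allI tv_le_1)
  qed
  ultimately show ?thesis unfolding has_cutoff_def d_def t_def by blast
qed

end
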